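(* Let $T$ be a tree with maximum degree $\Delta(T)=3$ having at least two vertices of degree $3$. Then $\lambda(T)=4$ if and only if $T$ is good.
   Context: An $L(2,1)$-labeling of a graph $G$ is a map $f:V(G)\to\mathbb{Z}_{\ge 0}$ such that $|f(x)-f(y)|\ge 2$ whenever $x,y$ are adjacent and $f(x)\neq f(y)$ whenever $x,y$ are at distance $2$. $\lambda(G)$ is the least $k$ such that $G$ has an $L(2,1)$-labeling with all labels in $\{0,1,\dots,k\}$. Let $T$ be a tree with maximum degree $3$. A major vertex is a vertex of degree $3$; a leaf is a vertex of degree $1$. A handle is a vertex $v$ with $d(v)>1$ adjacent to at least $d(v)-1$ leaves; a major handle is a handle of degree $3$. For $k\ge 0$, a $k$-chain (or $uv$-chain) is a path $u x_1 x_2\cdots x_k v$ with $d(u)\ne 2$, $d(v)\ne 2$ and $d(x_i)=2$ for all $i$ (a $0$-chain is an edge $uv$). A chain is closed if both ends are major vertices, and open (also called terminal) if one end is a leaf and the other is a major vertex. A generalized major handle is a major vertex incident to at least two open chains. A subtree $T'$ of $T$ is strong if no vertex of degree $3$ in $T$ has degree $2$ in $T'$. Weights (defined when $T$ has at least two major vertices). Each major vertex $v$ lies on exactly three chains, and each of them gives $v$ a weight in $\{0,1,2,3,5,6,10,15\}$, defined recursively as follows. An open chain gives weight $1$ to its major end. A closed $k$-chain between major vertices $u,v$, oriented from $u$ to $v$ (written $[u(k)v]$), gives to $v$: weight $6$ if $k=0$; weight $15$ if $k=1$; if $k\ge 2$, let $a,b$ be the weights given to $u$ by the two other chains at $u$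 (these depend only on the part of $T$ on the side of $u$ away from $v$, so the recursion is well defined), and define the type $(c,k)$ of $[u(k)v]$ by: $c=0$ if $a=0$ or $b=0$; otherwise $c=1$ if $a,b\in\{1,2,3,5\}$ and $\gcd(a,b)=1$; $c=a$ if $a\in\{6,10,15\}$ and $\gcd(a,b)=1$ (symmetrically $c=b$ if $b\in\{6,10,15\}$ and $\gcd(a,b)=1$); $c=\gcd(a,b)$ if $\gcd(a,b)\in\{2,3,5\}$; $c=0$ if $\gcd(a,b)\in\{6,10,15\}$. The weight then given to $v$ is: $1$ for types $(1,2)$, $(1,k\ge4)$, $(2,k\ge7)$, $(3,k\ge7)$, $(5,k\ge6)$, $(6,k\ge5)$, $(10,k\ge4)$, $(15,k\ge5)$; $2$ for $(1,3)$, $(2,5)$, $(3,6)$, $(5,3)$, $(6,2)$, $(10,3)$, $(15,3)$; $3$ for $(2,6)$, $(3,5)$, $(10,2)$, $(15,4)$; $5$ for $(2,4)$, $(5,5)$, $(6,4)$, $(15,2)$; $6$ for $(2,2)$, $(3,3)$, $(5,4)$, $(6,3)$; $10$ for $(3,2)$; $15$ for $(3,4)$, $(5,2)$; $0$ for $(0,k\ge2)$ and $(2,3)$. A major vertex $u$ of $T$ is bad if (B1) some closed chain incident to $u$, oriented away from $u$, is of type $(2,3)$; or (B2) two of the three chains incident to $u$ give $u$ the same weight and this weight is $6$, $10$ or $15$; or (B3) the three weights received by $u$ are all positive and their greatest common divisor is greater than $1$. A major vertex is good if it is not bad. A strong subtree $T^*$ of $T$ is bad if: (1) $T^*$ has a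 vertex of degree $3$; (2) for each generalized major handle $u$ of $T^*$, either two of its terminal chains are closed $3$-chains in $T$, or one of its incident chains is a closed $0$-chain or closed $1$-chain in $T$; (3) no two major vertices of $T^*$ are adjacent and no vertex of degree $2$ of $T^*$ is adjacent to two different major vertices of $T^*$; (4) some vertex of degree $3$ of $T^*$ is bad (weights and types computed in $T$). $T$ is bad if it contains a bad strong subtree, and good otherwise. *)

theory Defs
  imports Main "HOL-Library.Extended_Nat"
begin

section \<open>Finite simple graphs and trees\<close>

record 'a ugraph =
  verts :: "'a set"
  edges :: "'a set set"

definition simple_graph :: "'a ugraph \<Rightarrow> bool" where
  "simple_graph G \<longleftrightarrow>
     finite (verts G) \<and> (\<forall>e\<in>edges G. e \<subseteq> verts G \<and> card e = 2)"

definition adj :: "'a ugraph \<Rightarrow> 'a \<Rightarrow> 'a \<Rightarrow> bool" where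
  "adj G x y \<longleftrightarrow> {x, y} \<in> edges G"

definition vdegree :: "'a ugraph \<Rightarrow> 'a \<Rightarrow> nat" where
  "vdegree G v = card {w \<in> verts G. adj G v w}"

definition max_degree :: "'a ugraph \<Rightarrow> nat" where
  "max_degree G = Max (vdegree G ` verts G)"

definition walk :: "'a ugraph \<Rightarrow> 'a list \<Rightarrow> bool" where
  "walk G p \<longleftrightarrow> p \<noteq> [] \<and> set p \<subseteq> verts G \<and> successively (adj G) p"

definition path :: "'a ugraph \<Rightarrow> 'a list \<Rightarrow> bool" where
  "path G p \<longleftrightarrow> walk G p \<and> distinct p"

text \<open>The number of edges of a shortest walk; \<open>\<infinity>\<close> if there is no walk.\<close>

definition gdist :: "'a ugraph \<Rightarrow> 'a \<Rightarrow> 'a \<Rightarrow> enat" where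
  "gdist G x y = (INF p \<in> {p. walk G p \<and> hd p = x \<and> last p = y}. enat (length p - 1))"

definition graph_connected :: "'a ugraph \<Rightarrow> bool" where
  "graph_connected G \<longleftrightarrow>
     (\<forall>x\<in>verts G. \<forall>y\<in>verts G. \<exists>p. path G p \<and> hd p = x \<and> last p = y)"

definition graph_cycle :: "'a ugraph \<Rightarrow> 'a list \<Rightarrow> bool" where
  "graph_cycle G p \<longleftrightarrow> path G p \<and> length p \<ge> 3 \<and> adj G (last p) (hd p)"

definition tree :: "'a ugraph \<Rightarrow> bool" where
  "tree G \<longleftrightarrow>
     simple_graph G \<and> verts G \<noteq> {} \<and> graph_connected G \<and> (\<nexists>p. graph_cycle G p)"

definition subtree :: "'a ugraph \<Rightarrow> 'a ugraph \<Rightarrow> bool" where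
  "subtree S T \<longleftrightarrow> tree S \<and> verts S \<subseteq> verts T \<and> edges S \<subseteq> edges T"


section \<open>L(2,1)-labelings\<close>

text \<open>Only the values of a labeling on \<open>verts G\<close> matter.\<close>

definition L21_labeling :: "'a ugraph \<Rightarrow> ('a \<Rightarrow> nat) \<Rightarrow> bool" where
  "L21_labeling G f \<longleftrightarrow>
     (\<forall>x\<in>verts G. \<forall>y\<in>verts G.
        (adj G x y \<longrightarrow> \<bar>int (f x) - int (f y)\<bar> \<ge> 2) \<and>
        (gdist G x y = 2 \<longrightarrow> f x \<noteq> f y))"

definition lambda_number :: "'a ugraph \<Rightarrow> nat" where
  "lambda_number G = (LEAST k. \<exists>f. L21_labeling G f \<and> (\<forall>x\<in>verts G. f x \<le> k))"


section \<open>Chains\<close>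

definition major :: "'a ugraph \<Rightarrow> 'a \<Rightarrow> bool" where
  "major G v \<longleftrightarrow> v \<in> verts G \<and> vdegree G v = 3"

definition leaf :: "'a ugraph \<Rightarrow> 'a \<Rightarrow> bool" where
  "leaf G v \<longleftrightarrow> v \<in> verts G \<and> vdegree G v = 1"

text \<open>A \<open>k\<close>-chain is represented by its vertex list, hence comes with an orientation from
  \<open>hd p\<close> to \<open>last p\<close>; the same chain with the opposite orientation is \<open>rev p\<close>.\<close>

definition chain :: "'a ugraph \<Rightarrow> nat \<Rightarrow> 'a list \<Rightarrow> bool" where
  "chain G k p \<longleftrightarrow>
     path G p \<and> length p = k + 2 \<and>
     vdegree G (hd p) \<noteq> 2 \<and> vdegree G (last p) \<noteq> 2 \<and>
     (\<forall>x \<in> set (butlast (tl p)). vdegree G x = 2)"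

definition closed_chain :: "'a ugraph \<Rightarrow> nat \<Rightarrow> 'a list \<Rightarrow> bool" where
  "closed_chain G k p \<longleftrightarrow> chain G k p \<and> major G (hd p) \<and> major G (last p)"

definition open_chain :: "'a ugraph \<Rightarrow> nat \<Rightarrow> 'a list \<Rightarrow> bool" where
  "open_chain G k p \<longleftrightarrow>
     chain G k p \<and>
     (leaf G (hd p) \<and> major G (last p) \<or> major G (hd p) \<and> leaf G (last p))"

text \<open>The chains incident to \<open>v\<close>, each listed once, in its orientation towards \<open>v\<close>.\<close>

definition chains_to :: "'a ugraph \<Rightarrow> 'a \<Rightarrow> 'a list set" where
  "chains_to G v = {p. (\<exists>k. chain G k p) \<and> last p = v}"

definition gen_major_handle :: "'a ugraph \<Rightarrow> 'a \<Rightarrow> bool" where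
  "gen_major_handle G u \<longleftrightarrow>
     major G u \<and>
     (\<exists>p\<in>chains_to G u. \<exists>q\<in>chains_to G u.
        p \<noteq> q \<and> (\<exists>k. open_chain G k p) \<and> (\<exists>k. open_chain G k q))"


section \<open>Weights and types\<close>

definition type_of_weights :: "nat \<Rightarrow> nat \<Rightarrow> nat" where
  "type_of_weights a b =
     (if a = 0 \<or> b = 0 then 0
      else if a \<in> {1,2,3,5} \<and> b \<in> {1,2,3,5} \<and> gcd a b = 1 then 1
      else if a \<in> {6,10,15} \<and> gcd a b = 1 then a
      else if b \<in> {6,10,15} \<and> gcd a b = 1 then b
      else if gcd a b \<in> {2,3,5} then gcd a b
      else 0)"

text \<open>The last case below consists exactly of the types \<open>(0, k)\<close> and \<open>(2, 3)\<close>,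
  for \<open>c \<in> {0,1,2,3,5,6,10,15}\<close> and \<open>k \<ge> 2\<close>.\<close>

definition weight_of_type :: "nat \<Rightarrow> nat \<Rightarrow> nat" where
  "weight_of_type c k =
     (if c = 1 \<and> k = 2 \<or> c = 1 \<and> k \<ge> 4 \<or> c = 2 \<and> k \<ge> 7 \<or> c = 3 \<and> k \<ge> 7 \<or>
         c = 5 \<and> k \<ge> 6 \<or> c = 6 \<and> k \<ge> 5 \<or> c = 10 \<and> k \<ge> 4 \<or> c = 15 \<and> k \<ge> 5 then 1
      else if (c, k) \<in> {(1,3), (2,5), (3,6), (5,3), (6,2), (10,3), (15,3)} then 2
      else if (c, k) \<in> {(2,6), (3,5), (10,2), (15,4)} then 3
      else if (c, k) \<in> {(2,4), (5,5), (6,4), (15,2)} then 5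
      else if (c, k) \<in> {(2,2), (3,3), (5,4), (6,3)} then 6
      else if (c, k) \<in> {(3,2)} then 10
      else if (c, k) \<in> {(3,4), (5,2)} then 15
      else 0)"

text \<open>\<open>gives_weight T p w\<close>: the chain \<open>p\<close> gives the weight \<open>w\<close> to its end \<open>last p\<close>.
  \<open>has_type T p c k\<close>: the chain \<open>p\<close>, closed and oriented from \<open>hd p\<close> to \<open>last p\<close>,
  has type \<open>(c, k)\<close>. The recursion passes to the two other chains at \<open>hd p\<close>; on a finite tree
  it is well-founded, so the smallest relations closed under these rules are its solution.\<close>

inductive gives_weight :: "'a ugraph \<Rightarrow> 'a list \<Rightarrow> nat \<Rightarrow> bool"
  and has_type :: "'a ugraph \<Rightarrow> 'a list \<Rightarrow> nat \<Rightarrow> nat \<Rightarrow> bool"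
  for T :: "'a ugraph"
where
  weight_open: "open_chain T k p \<Longrightarrow> major T (last p) \<Longrightarrow> gives_weight T p 1"
| weight_closed_0: "closed_chain T 0 p \<Longrightarrow> gives_weight T p 6"
| weight_closed_1: "closed_chain T 1 p \<Longrightarrow> gives_weight T p 15"
| weight_closed: "has_type T p c k \<Longrightarrow> gives_weight T p (weight_of_type c k)"
| type_closed:
    "closed_chain T k p \<Longrightarrow> k \<ge> 2 \<Longrightarrow>
     q \<in> chains_to T (hd p) \<Longrightarrow> r \<in> chains_to T (hd p) \<Longrightarrow>
     q \<noteq> r \<Longrightarrow> q \<noteq> rev p \<Longrightarrow> r \<noteq> rev p \<Longrightarrow>
     gives_weight T q a \<Longrightarrow> gives_weight T r b \<Longrightarrow>
     has_type T p (type_of_weights a b) k"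


section \<open>Good and bad trees\<close>

definition B1 :: "'a ugraph \<Rightarrow> 'a \<Rightarrow> bool" where
  "B1 T u \<longleftrightarrow> (\<exists>p k. closed_chain T k p \<and> hd p = u \<and> has_type T p 2 3)"

definition B2 :: "'a ugraph \<Rightarrow> 'a \<Rightarrow> bool" where
  "B2 T u \<longleftrightarrow>
     (\<exists>p\<in>chains_to T u. \<exists>q\<in>chains_to T u. \<exists>w\<in>{6,10,15}.
        p \<noteq> q \<and> gives_weight T p w \<and> gives_weight T q w)"

definition B3 :: "'a ugraph \<Rightarrow> 'a \<Rightarrow> bool" where
  "B3 T u \<longleftrightarrow>
     (\<exists>p\<in>chains_to T u. \<exists>q\<in>chains_to T u. \<exists>r\<in>chains_to T u. \<exists>a b c.
        distinct [p, q, r] \<and>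
        gives_weight T p a \<and> gives_weight T q b \<and> gives_weight T r c \<and>
        a > 0 \<and> b > 0 \<and> c > 0 \<and> gcd a (gcd b c) > 1)"

definition bad_vertex :: "'a ugraph \<Rightarrow> 'a \<Rightarrow> bool" where
  "bad_vertex T u \<longleftrightarrow> major T u \<and> (B1 T u \<or> B2 T u \<or> B3 T u)"

definition strong_subtree :: "'a ugraph \<Rightarrow> 'a ugraph \<Rightarrow> bool" where
  "strong_subtree S T \<longleftrightarrow>
     subtree S T \<and> \<not> (\<exists>v\<in>verts S. vdegree T v = 3 \<and> vdegree S v = 2)"

text \<open>In condition (2), the terminal and incident chains are chains of the subtree \<open>S\<close>, which are
  then required to be, as vertex lists, closed chains of the ambient tree \<open>T\<close>.\<close>

definition bad_strong_subtree :: "'a ugraph \<Rightarrow> 'a ugraph \<Rightarrow> bool" where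
  "bad_strong_subtree S T \<longleftrightarrow>
     strong_subtree S T \<and>
     \<comment> \<open>(1)\<close>
     (\<exists>v. major S v) \<and>
     \<comment> \<open>(2)\<close>
     (\<forall>u. gen_major_handle S u \<longrightarrow>
        (\<exists>p\<in>chains_to S u. \<exists>q\<in>chains_to S u.
           p \<noteq> q \<and> (\<exists>k. open_chain S k p) \<and> (\<exists>k. open_chain S k q) \<and>
           closed_chain T 3 p \<and> closed_chain T 3 q) \<or>
        (\<exists>p\<in>chains_to S u. closed_chain T 0 p \<or> closed_chain T 1 p)) \<and>
     \<comment> \<open>(3)\<close>
     (\<forall>u v. major S u \<and> major S v \<longrightarrow> \<not> adj S u v) \<and>
     \<not> (\<exists>x\<in>verts S. vdegree S x = 2 \<and>
          (\<exists>u v. u \<noteq> v \<and> major S u \<and> major S v \<and> adj S x u \<and> adj S x v)) \<and>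
     \<comment> \<open>(4)\<close>
     (\<exists>v. major S v \<and> bad_vertex T v)"

definition bad_tree :: "'a ugraph \<Rightarrow> bool" where
  "bad_tree T \<longleftrightarrow> (\<exists>S. bad_strong_subtree S T)"

definition good_tree :: "'a ugraph \<Rightarrow> bool" where
  "good_tree T \<longleftrightarrow> \<not> bad_tree T"

end

theory Submission
  imports Defs
begin

text \<open>
  With labels in \<open>{0,\<dots>,4}\<close> a major vertex is labeled 0 or 4, and by the symmetry \<open>j \<mapsto> 4 - j\<close>
  one may say that it is labeled 0 and that its neighbours carry the labels 2, 3, 4. The primes 2, 3, 5
  stand for these three labels: a weight \<open>a > 0\<close> that a chain gives to its end \<open>v\<close> is the product of the
  primes of the labels that the last inner vertex of the chain cannot carry, and 0 means that no label is
  left. In the type \<open>(c, k)\<close> the number \<open>c \<noteq> 1\<close> is the product of the primes of the labels that the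
  first inner vertex can carry. Hence \<open>T\<close> has a labeling if and only if at each major vertex the three
  weights admit a system of distinct labels (Hall's condition), and this fails exactly at bad vertices.
  It remains to see that a bad vertex \<open>u\<close> lies in a bad strong subtree: grow a subtree from \<open>u\<close> and
  stop at each major vertex whose chain towards \<open>u\<close> has length at most 1 or is of type \<open>(1, k)\<close>.
  At a generalized major handle of this subtree without chains of length at most 1, open chains give
  weight 1 or, only in the case of 3-chains, 2; if one of two of them gave weight 1, the chain
  towards \<open>u\<close> would have type \<open>(1, k)\<close>.
\<close>

section \<open>Labels along a chain\<close>

text \<open>Labels relative to an end labeled 0: those left for the neighbour of this end on a chain
  of weight \<open>a\<close>. The primes dividing \<open>a\<close> are the excluded labels, and 5
  stands for the label 4.\<close>

definition weight_labels :: "nat \<Rightarrow> nat set" where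
  "weight_labels a = (if a = 0 then {} else {x \<in> {2,3,4}. \<not> (if x = 4 then 5 else x) dvd a})"

definition type_labels :: "nat \<Rightarrow> nat set" where
  "type_labels c =
     (if c = 0 then {} else if c = 1 then {2,3,4} else {x \<in> {2,3,4}. (if x = 4 then 5 else x) dvd c})"

text \<open>Reduces a vertex labeled \<open>i = 4\<close> to one labeled 0 by the reflection of the
  labels; \<open>i\<close> is meant to be 0 or 4.\<close>

definition rel_label :: "nat \<Rightarrow> nat \<Rightarrow> nat" where
  "rel_label i j = (if i = 0 then j else 4 - j)"

definition sep :: "nat \<Rightarrow> nat \<Rightarrow> bool" where
  "sep i j \<longleftrightarrow> i + 2 \<le> j \<or> j + 2 \<le> i"

definition edge_labels :: "(nat \<times> nat) list" where
  "edge_labels = filter (\<lambda>(i, j). sep i j) (List.product [0..<5] [0..<5])"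

text \<open>One transfer step along a chain. The states are pairs of consecutive labels because the
  condition at distance 2 involves three vertices.\<close>

definition next_labels :: "(nat \<times> nat) list \<Rightarrow> (nat \<times> nat) list" where
  "next_labels L = filter (\<lambda>(j, l). \<exists>(i, j') \<in> set L. j' = j \<and> i \<noteq> l) edge_labels"

text \<open>All pairs that the last two vertices of a \<open>k\<close>-chain can carry if its first
  end is a major vertex, labeled 0 or 4, and the type \<open>c\<close> restricts the vertex after
  it. With \<open>k\<close> inner vertices there are \<open>k + 1\<close> edges, hence
  \<open>k\<close> transfer steps from the first edge to the last.\<close>

primrec chain_labels :: "nat \<Rightarrow> nat \<Rightarrow> (nat \<times> nat) list" where
  "chain_labels c 0 =
     filter (\<lambda>(i, j). (i = 0 \<or> i = 4) \<and> rel_label i j \<in> type_labels c) edge_labels"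
| "chain_labels c (Suc k) = next_labels (chain_labels c k)"

definition weights :: "nat list" where "weights = [0,1,2,3,5,6,10,15]"

lemma mem_edge_labels: "(i, j) \<in> set edge_labels \<longleftrightarrow> sep i j \<and> i \<le> 4 \<and> j \<le> 4"
  by (auto simp: edge_labels_def)

lemma chain_labels_0:
  "(i, j) \<in> set (chain_labels c 0) \<longleftrightarrow>
     sep i j \<and> j \<le> 4 \<and> (i = 0 \<or> i = 4) \<and> rel_label i j \<in> type_labels c"
  by (auto simp: mem_edge_labels)

lemma chain_labels_Suc:
  "(j, l) \<in> set (chain_labels c (Suc k)) \<longleftrightarrow>
     sep j l \<and> j \<le> 4 \<and> l \<le> 4 \<and> (\<exists>i. (i, j) \<in> set (chain_labels c k) \<and> i \<noteq> l)"
  by (auto simp: mem_edge_labels next_labels_def)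

text \<open>Certifies the table of weights by evaluation: for chains with 2 to 7 inner vertices,
  what the transfer leaves at an end labeled 0 or 4 is what the tabulated weight leaves.\<close>

lemma chain_labels_small:
  "list_all (\<lambda>c. list_all (\<lambda>k. list_all (\<lambda>v. list_all (\<lambda>x.
      ((x, v) \<in> set (chain_labels c k)) = (sep v x \<and> rel_label v x \<in> weight_labels (weight_of_type c k)))
      [0..<5]) [0,4]) [2..<8]) weights"
  by code_simp

lemma chain_labels_7: "list_all (\<lambda>c. chain_labels c 7 = edge_labels) (tl weights)"
  by code_simp

lemma next_edge_labels: "next_labels edge_labels = edge_labels"
  by code_simp

text \<open>After seven steps every nonzero type has reached all admissible pairs, and the list of
  all these pairs is a fixed point of the transfer.\<close>

lemma chain_labels_large:
  assumes "c \<in> set (tl weights)" "k \<ge> 7" shows "chain_labels c k = edge_labels"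
  using assms(2)
proof (induction k rule: dec_induct)
  case base
  then show ?case using chain_labels_7 assms(1) by (simp only: list_all_iff)
qed (simp add: next_edge_labels)

lemma chain_labels_zero: "chain_labels 0 k = []"
  by (induction k) (auto simp: type_labels_def next_labels_def)

text \<open>Evaluation covers \<open>k < 8\<close>; beyond that the transfer is stationary and the
  table gives the weight 1 for every nonzero type.\<close>

lemma chain_labels_weight:
  assumes "c \<in> set weights" "k \<ge> 2" "v = 0 \<or> v = 4" "x \<le> 4"
  shows "(x, v) \<in> set (chain_labels c k) \<longleftrightarrow>
           sep v x \<and> rel_label v x \<in> weight_labels (weight_of_type c k)"
proof (cases "k < 8")
  case True
  then have "k \<in> set [2..<8]" "v \<in> set [0,4]" "x \<in> set [0..<5]" using assms by auto
  then show ?thesis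
    using chain_labels_small assms(1) unfolding list_all_iff by blast
next
  case False
  show ?thesis
  proof (cases "c = 0")
    case True
    then show ?thesis by (simp add: chain_labels_zero weight_of_type_def weight_labels_def)
  next
    case c: False
    then have "c \<in> set (tl weights)" using assms(1) by (auto simp: weights_def)
    then have "chain_labels c k = edge_labels" and "weight_of_type c k = 1"
      using False by (auto intro: chain_labels_large simp: weights_def weight_of_type_def)
    then show ?thesis using assms
      by (auto simp: mem_edge_labels weight_labels_def rel_label_def sep_def)
  qed
qed

section \<open>Arithmetic of weights and types\<close>

lemma weight_of_type_mem: "weight_of_type c k \<in> set weights"
  by (simp add: weight_of_type_def weights_def)

text \<open>Exhaustive evaluation over the eight weights. The third conjunct is the meaning of a
  type: the labels that the third neighbour of a major vertex can carry once the other two have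
  received distinct labels left by their weights. The last conjunct is Hall's theorem for the three
  label sets.\<close>

lemma type_of_weights_facts:
  "list_all (\<lambda>a. list_all (\<lambda>b. type_of_weights a b \<in> set weights \<and>
     type_of_weights a b = type_of_weights b a \<and>
     type_labels (type_of_weights a b) =
       Set.filter (\<lambda>z. \<exists>x\<in>weight_labels a. \<exists>y\<in>weight_labels b. distinct [x, y, z]) {2,3,4} \<and>
     (type_of_weights a b = 0 \<longrightarrow> a = 0 \<or> b = 0 \<or> a = b \<and> a \<in> {6, 10, 15}) \<and>
     (type_of_weights a b = 2 \<longrightarrow> 2 dvd a \<and> 2 dvd b) \<and>
     list_all (\<lambda>c. a > 0 \<longrightarrow> b > 0 \<longrightarrow> c > 0 \<longrightarrow> gcd a (gcd b c) = 1 \<longrightarrow>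
        (a = b \<longrightarrow> a \<notin> {6,10,15}) \<longrightarrow> (a = c \<longrightarrow> a \<notin> {6,10,15}) \<longrightarrow> (b = c \<longrightarrow> b \<notin> {6,10,15}) \<longrightarrow>
        (\<exists>x\<in>weight_labels a. \<exists>y\<in>weight_labels b. \<exists>z\<in>weight_labels c. distinct [x, y, z])) weights) weights) weights"
  by code_simp

lemma
  assumes "a \<in> set weights" "b \<in> set weights"
  shows type_of_weights_mem: "type_of_weights a b \<in> set weights"
    and type_of_weights_commute: "type_of_weights a b = type_of_weights b a"
    and type_of_weights_labels: "type_labels (type_of_weights a b) =
      Set.filter (\<lambda>z. \<exists>x\<in>weight_labels a. \<exists>y\<in>weight_labels b. distinct [x, y, z]) {2,3,4}"
    and type_of_weights_0:
      "type_of_weights a b = 0 \<Longrightarrow> a = 0 \<or> b = 0 \<or> a = b \<and> a \<in> {6, 10, 15}"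
    and type_of_weights_2: "type_of_weights a b = 2 \<Longrightarrow> 2 dvd a \<and> 2 dvd b"
    and distinct_labels_ex: "c \<in> set weights \<Longrightarrow> a > 0 \<Longrightarrow> b > 0 \<Longrightarrow> c > 0 \<Longrightarrow>
      gcd a (gcd b c) = 1 \<Longrightarrow> (a = b \<Longrightarrow> a \<notin> {6,10,15}) \<Longrightarrow> (a = c \<Longrightarrow> a \<notin> {6,10,15}) \<Longrightarrow>
      (b = c \<Longrightarrow> b \<notin> {6,10,15}) \<Longrightarrow>
      \<exists>x\<in>weight_labels a. \<exists>y\<in>weight_labels b. \<exists>z\<in>weight_labels c. distinct [x, y, z]"
proof -
  note * = type_of_weights_facts[unfolded list_all_iff, THEN bspec, OF assms(1), THEN bspec, OF assms(2)]
  show "type_of_weights a b \<in> set weights" using * by (elim conjE)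
  show "type_of_weights a b = type_of_weights b a" using * by (elim conjE)
  show "type_labels (type_of_weights a b) =
    Set.filter (\<lambda>z. \<exists>x\<in>weight_labels a. \<exists>y\<in>weight_labels b. distinct [x, y, z]) {2,3,4}"
    using * by (elim conjE)
  show "type_of_weights a b = 0 \<Longrightarrow> a = 0 \<or> b = 0 \<or> a = b \<and> a \<in> {6, 10, 15}"
    using * by (elim conjE) (erule mp)
  show "type_of_weights a b = 2 \<Longrightarrow> 2 dvd a \<and> 2 dvd b"
    using * by (elim conjE) (erule mp)
  assume c: "c \<in> set weights" and "a > 0" "b > 0" "c > 0" "gcd a (gcd b c) = 1"
    "a = b \<Longrightarrow> a \<notin> {6,10,15}" "a = c \<Longrightarrow> a \<notin> {6,10,15}" "b = c \<Longrightarrow> b \<notin> {6,10,15}"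
  then show "\<exists>x\<in>weight_labels a. \<exists>y\<in>weight_labels b. \<exists>z\<in>weight_labels c. distinct [x, y, z]"
    using *[THEN conjunct2, THEN conjunct2, THEN conjunct2, THEN conjunct2, THEN conjunct2,
        THEN bspec, OF c] by (simp only:) blast
qed

text \<open>A prime dividing all three weights stands for a label excluded at all three neighbours.
  Zero weights fit in: they are divisible by every prime and exclude every label.\<close>

lemma common_excluded_label:
  "list_all (\<lambda>a. list_all (\<lambda>b. list_all (\<lambda>c. gcd a (gcd b c) > 1 \<longrightarrow>
     (\<exists>n\<in>{2,3,4}. n \<notin> weight_labels a \<and> n \<notin> weight_labels b \<and> n \<notin> weight_labels c))
     weights) weights) weights"
  by code_simp

lemma label_constants:
  "weight_labels (Suc 0) = {2,3,4}" "weight_labels 6 = {4}" "weight_labels 10 = {3}"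
  "weight_labels 15 = {2}"
  by (auto simp: weight_labels_def)

lemma weight_of_type_eq_0:
  assumes "c \<in> set weights" "k \<ge> 2" "weight_of_type c k = 0"
  shows "c = 0 \<or> c = 2 \<and> k = 3"
proof (cases "k \<ge> 7")
  case True
  then show ?thesis using assms by (auto simp: weights_def weight_of_type_def)
next
  case False
  then have "k \<in> {2,3,4,5,6}" using assms(2) by auto
  then show ?thesis using assms by (auto simp: weights_def weight_of_type_def)
qed

lemma chain_labels_edge: "(i, j) \<in> set (chain_labels c k) \<Longrightarrow> sep i j \<and> i \<le> 4 \<and> j \<le> 4"
  by (cases k) (auto simp: chain_labels_0 chain_labels_Suc simp del: chain_labels.simps)

lemma sep_sym: "sep i j \<longleftrightarrow> sep j i"
  by (auto simp: sep_def)

text \<open>Each label from 0 to 4 is compatible with at least two others, so one of them differs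
  from \<open>i\<close>. This labels chains that end in a leaf.\<close>

lemma edge_label_extend: "sep i j \<Longrightarrow> j \<le> 4 \<Longrightarrow> \<exists>h\<le>4. sep j h \<and> h \<noteq> i"
proof -
  assume "sep i j" "j \<le> 4"
  then show ?thesis
    by (intro exI[of _ "if j = 0 then if i = 2 then 3 else 2 else if j = 1 then if i = 3 then 4 else 3
        else if j = 2 then 4 - i else if i = 0 then 1 else 0"]) (auto simp: sep_def)
qed

text \<open>The label of the first vertex of a list that leads back to the root.\<close>

fun path_label :: "('a \<Rightarrow> nat) \<Rightarrow> ('a \<Rightarrow> 'a \<Rightarrow> nat \<Rightarrow> nat \<Rightarrow> 'a \<Rightarrow> nat) \<Rightarrow> 'a list \<Rightarrow> nat" where
  "path_label g0 g (z # x # v # r) =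
     g v x (path_label g0 g (v # r)) (path_label g0 g (x # v # r)) z"
| "path_label g0 g [x, u] = g0 x"
| "path_label g0 g _ = 0"

section \<open>Paths and chains in trees\<close>

definition nbrs :: "'a ugraph \<Rightarrow> 'a \<Rightarrow> 'a set" where
  "nbrs G v = {w \<in> verts G. adj G v w}"

text \<open>A local substitute for distinctness, easy to preserve when walks are extended or joined;
  in a tree the two agree for walks.\<close>

fun nonbacktracking :: "'a list \<Rightarrow> bool" where
  "nonbacktracking (x # y # z # p) \<longleftrightarrow> x \<noteq> z \<and> nonbacktracking (y # z # p)"
| "nonbacktracking _ \<longleftrightarrow> True"

lemma nonbacktracking_distinct: "distinct p \<Longrightarrow> nonbacktracking p"
  by (induction p rule: nonbacktracking.induct) auto

lemma nonbacktracking_ConsD: "nonbacktracking (x # p) \<Longrightarrow> nonbacktracking p"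
  by (cases "x # p" rule: nonbacktracking.cases) auto

lemma nonbacktracking_append:
  assumes "nonbacktracking (p @ [v])" "nonbacktracking (v # q)"
    "p \<noteq> [] \<Longrightarrow> q \<noteq> [] \<Longrightarrow> last p \<noteq> hd q"
  shows "nonbacktracking (p @ v # q)"
  using assms
proof (induction p)
  case (Cons x p)
  have "p \<noteq> [] \<Longrightarrow> q \<noteq> [] \<Longrightarrow> last p \<noteq> hd q" using Cons.prems(3) by auto
  then have IH: "nonbacktracking (p @ v # q)"
    using Cons.IH nonbacktracking_ConsD[of x "p @ [v]"] Cons.prems by simp
  show ?case
  proof (cases p)
    case Nil
    then show ?thesis using Cons.prems by (cases q) auto
  next
    case (Cons y p')
    then show ?thesis using IH Cons.prems Cons by (cases p') auto
  qed
qed simp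

text \<open>\<open>run G x p\<close>: the list \<open>x # p\<close> leaves \<open>x\<close> along \<open>hd p\<close> and follows vertices of degree 2
  up to the first vertex of another degree; \<open>x\<close> itself may have any degree.\<close>

fun run :: "'a ugraph \<Rightarrow> 'a \<Rightarrow> 'a list \<Rightarrow> bool" where
  "run G x [] \<longleftrightarrow> False"
| "run G x [y] \<longleftrightarrow> adj G x y \<and> vdegree G y \<noteq> 2"
| "run G x (y # z # p) \<longleftrightarrow> adj G x y \<and> vdegree G y = 2 \<and> z \<noteq> x \<and> run G y (z # p)"

text \<open>Cutting out the part between two occurrences of a vertex shortens the walk. The graph is
  arbitrary because the grown subgraph must be shown connected before it is known to be a
  tree.\<close>

lemma walk_imp_path:
  "walk H p \<Longrightarrow> \<exists>q. path H q \<and> hd q = hd p \<and> last q = last p"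
proof (induction "length p" arbitrary: p rule: less_induct)
  case less
  show ?case
  proof (cases "distinct p")
    case True
    then show ?thesis using less.prems by (auto simp: path_def)
  next
    case False
    then obtain xs a ys zs where p: "p = xs @ [a] @ ys @ [a] @ zs" using not_distinct_decomp by blast
    then have "p = (xs @ a # ys) @ (a # zs)" by simp
    then have "successively (adj H) (a # zs)"
      using less.prems unfolding walk_def by (metis successively_append_iff)
    then have "walk H (xs @ [a] @ zs)"
      using less.prems p by (auto simp: walk_def successively_append_iff)
    then obtain q where "path H q" "hd q = hd (xs @ [a] @ zs)" "last q = last (xs @ [a] @ zs)"
      using less.hyps[of "xs @ [a] @ zs"] p by auto
    then show ?thesis using p by (auto simp: hd_append)
  qed
qed

locale finite_tree =
  fixes G :: "'a ugraph"
  assumes tree: "tree G"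
begin

lemma simple: "finite (verts G)" "\<And>e. e \<in> edges G \<Longrightarrow> e \<subseteq> verts G \<and> card e = 2"
  using tree by (auto simp: tree_def simple_graph_def)

lemma adj_sym: "adj G x y \<longleftrightarrow> adj G y x"
  by (simp add: adj_def insert_commute)

lemma adj_verts: "adj G x y \<Longrightarrow> x \<in> verts G \<and> y \<in> verts G"
  using simple(2) by (auto simp: adj_def)

lemma adj_irrefl: "\<not> adj G x x"
  using simple(2)[of "{x}"] by (auto simp: adj_def)

lemma mem_nbrs: "y \<in> nbrs G x \<longleftrightarrow> adj G x y"
  using adj_verts by (auto simp: nbrs_def)

lemma finite_nbrs: "finite (nbrs G x)"
  using simple(1) by (auto simp: nbrs_def)

lemma vdegree_nbrs: "vdegree G x = card (nbrs G x)"
  by (simp add: vdegree_def nbrs_def)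

lemma walk_iff: "walk G p \<longleftrightarrow> p \<noteq> [] \<and> hd p \<in> verts G \<and> successively (adj G) p"
proof (induction p)
  case (Cons x p)
  then show ?case
    by (cases p) (auto simp: walk_def dest: adj_verts)
qed (simp add: walk_def)

text \<open>If the tail is distinct and its head vertex \<open>x\<close> recurs, the part of the
  tail up to the recurrence closes a cycle: it has at least three vertices since there are no loops
  and no immediate returns.\<close>

lemma nonbacktracking_path:
  assumes "walk G p" "nonbacktracking p" shows "path G p"
proof -
  have "distinct p" using assms
  proof (induction p)
    case (Cons x p)
    show ?case
    proof (cases "p = []")
      case False
      then have p: "walk G p" "adj G x (hd p)" using Cons.prems
        by (auto simp: walk_def successively_Cons)
      then have d: "distinct p" using Cons.IH nonbacktracking_ConsD[OF Cons.prems(2)] by simp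
      have "x \<notin> set p"
      proof
        assume "x \<in> set p"
        then obtain ys zs where ys: "p = ys @ x # zs" "x \<notin> set ys" by (meson split_list_first)
        have "ys \<noteq> []" using ys p(2) adj_irrefl by auto
        moreover have "length ys \<noteq> 1"
          using ys Cons.prems(2) by (auto simp: length_Suc_conv)
        ultimately have l: "length ys \<ge> 2" by (cases ys rule: nonbacktracking.cases) auto
        have "walk G (ys @ [x])" using p(1) ys(1)
          by (auto simp: walk_def successively_append_iff)
        then have "graph_cycle G (ys @ [x])"
          using l d ys p(2) by (auto simp: graph_cycle_def path_def hd_append)
        then show False using tree by (simp add: tree_def)
      qed
      then show ?thesis using d by simp
    qed simp
  qed simp
  then show ?thesis using assms by (simp add: path_def)
qed

lemma path_iff: "path G p \<longleftrightarrow> walk G p \<and> nonbacktracking p"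
  using nonbacktracking_path nonbacktracking_distinct by (auto simp: path_def)

lemma path_length: "path G p \<Longrightarrow> length p \<le> card (verts G)"
  using simple(1) by (metis card_mono distinct_card path_def walk_def)

lemma path_extend:
  assumes "path G (p @ [x, y])" "adj G y z" "z \<noteq> x" shows "path G (p @ [x, y, z])"
proof -
  have "nonbacktracking ((p @ [x]) @ y # [z])"
    by (rule nonbacktracking_append) (use assms in \<open>auto simp: path_iff\<close>)
  moreover have "walk G (p @ [x, y, z])"
    using assms adj_verts by (auto simp: path_def walk_def successively_append_iff)
  ultimately show ?thesis by (simp add: path_iff)
qed

lemma path_append:
  assumes "path G (p @ [v])" "path G (v # q)" "p \<noteq> [] \<Longrightarrow> q \<noteq> [] \<Longrightarrow> last p \<noteq> hd q"
  shows "path G (p @ v # q)"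
proof -
  have "nonbacktracking (p @ v # q)"
    by (rule nonbacktracking_append) (use assms in \<open>auto simp: path_iff\<close>)
  moreover have "walk G (p @ v # q)"
    using assms by (auto simp: path_def walk_def successively_append_iff)
  ultimately show ?thesis by (simp add: path_iff)
qed

lemma path_rev: "path G (rev p) \<longleftrightarrow> path G p"
  by (auto simp: path_def walk_def adj_sym)

lemma path_edge: "adj G x y \<Longrightarrow> path G [x, y]"
  using adj_irrefl adj_verts by (auto simp: path_def walk_def)

text \<open>If the vertices before \<open>v\<close> differ, one path followed by the reverse of the
  other does not backtrack and is therefore a path, although it begins and ends at the same
  vertex.\<close>

lemma path_unique:
  "path G (p @ [v]) \<Longrightarrow> path G (q @ [v]) \<Longrightarrow> hd (p @ [v]) = hd (q @ [v]) \<Longrightarrow> p = q"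
proof (induction p arbitrary: q v rule: rev_induct)
  case Nil
  then show ?case by (cases q) (auto simp: path_def)
next
  case (snoc x p)
  have "q \<noteq> []" using snoc.prems by (auto simp: path_def hd_append split: if_splits)
  then obtain y q' where q: "q = q' @ [y]" by (metis rev_exhaust)
  have 1: "path G (p @ [x])" "path G (q' @ [y])" "adj G x v" "adj G y v"
    using snoc.prems q by (auto simp: path_def walk_def successively_append_iff)
  have h: "hd (p @ [x]) = hd (q' @ [y])" using snoc.prems(3) q by (auto simp: hd_append)
  show ?case
  proof (cases "x = y")
    case True
    then show ?thesis using snoc.IH[of y q'] 1 q h by auto
  next
    case False
    have vq: "path G (v # rev q)" using snoc.prems(2) path_rev[of "q @ [v]"] by simp
    have "path G ((p @ [x]) @ v # rev q)"
      by (rule path_append[OF _ vq]) (use snoc.prems(1) False q in simp_all)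
    then have "distinct (p @ [x] @ v # rev q)" by (simp add: path_def)
    moreover have "hd (p @ [x]) \<in> set (p @ [x])" "hd (q' @ [y]) \<in> set q"
      unfolding q by (rule list.set_sel(1), simp)+
    ultimately show ?thesis using h by fastforce
  qed
qed

lemma path_ex: "x \<in> verts G \<Longrightarrow> y \<in> verts G \<Longrightarrow> \<exists>p. path G p \<and> hd p = x \<and> last p = y"
  using tree by (auto simp: tree_def graph_connected_def)

section \<open>Chains addressed by a vertex and a neighbour\<close>

lemma run_iff:
  "run G x p \<longleftrightarrow> p \<noteq> [] \<and> walk G (x # p) \<and> nonbacktracking (x # p) \<and> vdegree G (last p) \<noteq> 2 \<and>
     (\<forall>y\<in>set (butlast p). vdegree G y = 2)"
proof (induction p arbitrary: x rule: induct_list012)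
  case (2 y)
  then show ?case using adj_verts by (auto simp: walk_def)
next
  case (3 y z p)
  show ?case using "3.IH"(2)[of y] adj_verts by (auto simp: walk_def)
qed simp

lemma chain_iff_run: "chain G k (v # p) \<longleftrightarrow> vdegree G v \<noteq> 2 \<and> run G v p \<and> length p = k + 1"
  by (cases p) (auto simp: chain_def run_iff path_iff)

lemma chain_rev: "chain G k (rev p) \<longleftrightarrow> chain G k p"
proof (cases "p = []")
  case False
  have "tl (rev p) = rev (butlast p)" "butlast (tl p) = tl (butlast p)"
    by (cases p rule: rev_cases; simp) (simp add: butlast_tl)
  then have "set (butlast (tl (rev p))) = set (butlast (tl p))"
    by (simp add: butlast_rev)
  then show ?thesis using False by (auto simp: chain_def path_rev hd_rev last_rev)
qed (simp add: chain_def)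

lemma run_unique: "run G x (y # p) \<Longrightarrow> run G x (y # q) \<Longrightarrow> p = q"
proof (induction p arbitrary: x y q)
  case Nil
  then show ?case by (cases q) auto
next
  case (Cons z p)
  then obtain z' q' where q: "q = z' # q'" by (cases q) auto
  have 1: "card (nbrs G y) = 2" "z \<in> nbrs G y" "z' \<in> nbrs G y" "x \<in> nbrs G y" "z \<noteq> x" "z' \<noteq> x"
    using Cons.prems q adj_sym by (auto simp: mem_nbrs vdegree_nbrs run_iff walk_iff)
  then have "z = z'" by (auto simp: card_2_iff)
  then show ?case using Cons.IH[of y z q'] Cons.prems q by auto
qed

lemma run_ex: assumes "adj G x y" shows "\<exists>p. run G x (y # p)"
proof -
  \<comment> \<open>The prefix \<open>q\<close> serves the induction measure: it grows with each
    step, and no path has more vertices than the tree.\<close>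
  have "path G (q @ [x, y]) \<Longrightarrow> \<exists>p. run G x (y # p)" for q
  proof (induction "card (verts G) - length q" arbitrary: q x y rule: less_induct)
    case less
    have a: "adj G x y" using less.prems by (auto simp: path_def walk_def successively_append_iff)
    show ?case
    proof (cases "vdegree G y = 2")
      case False
      then have "run G x [y]" using a by simp
      then show ?thesis by blast
    next
      case True
      then obtain z where z: "z \<noteq> x" "adj G y z"
        by (metis card_2_iff' mem_nbrs vdegree_nbrs)
      then have p: "path G ((q @ [x]) @ [y, z])" using path_extend less.prems by simp
      have "card (verts G) - length (q @ [x]) < card (verts G) - length q"
        using path_length[OF p] by simp
      from less.hyps[OF this p] obtain r where "run G y (z # r)" by blast
      then have "run G x (y # z # r)" using True a z by simp
      then show ?thesis by blast
    qed
  qed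
  from this[of "[]"] show ?thesis using path_edge assms by simp
qed

text \<open>A chain at \<open>v\<close> is addressed by the neighbour \<open>x\<close> through which
  it leaves \<open>v\<close>. Then \<open>far v x\<close> and \<open>entry v x\<close> address the
  same chain from its other end; on a 0-chain \<open>entry v x\<close> is \<open>v\<close>. Since
  \<open>v\<close> may have degree 2, recursions can run along the inner vertices of a
  chain.\<close>

definition ochain :: "'a \<Rightarrow> 'a \<Rightarrow> 'a list" where
  "ochain v x = x # (THE p. run G v (x # p))"

definition far :: "'a \<Rightarrow> 'a \<Rightarrow> 'a" where
  "far v x = last (ochain v x)"

definition entry :: "'a \<Rightarrow> 'a \<Rightarrow> 'a" where
  "entry v x = last (butlast (v # ochain v x))"

definition clen :: "'a \<Rightarrow> 'a \<Rightarrow> nat" where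
  "clen v x = length (ochain v x) - 1"

definition tochain :: "'a \<Rightarrow> 'a \<Rightarrow> 'a list" where
  "tochain v x = rev (v # ochain v x)"

lemma run_ochain: "adj G v x \<Longrightarrow> run G v (ochain v x)"
  unfolding ochain_def using run_ex run_unique by (metis theI)

lemma ochain_eq: "run G v (x # p) \<Longrightarrow> ochain v x = x # p"
  unfolding ochain_def using run_unique by blast

lemma hd_ochain: "hd (ochain v x) = x" "ochain v x \<noteq> []"
  by (simp_all add: ochain_def)

lemma chain_ochain: "adj G v x \<Longrightarrow> vdegree G v \<noteq> 2 \<Longrightarrow> chain G (clen v x) (v # ochain v x)"
  by (simp add: chain_iff_run run_ochain clen_def hd_ochain(2) Suc_leI)

lemma chain_tochain: "adj G v x \<Longrightarrow> vdegree G v \<noteq> 2 \<Longrightarrow> chain G (clen v x) (tochain v x)"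
  unfolding tochain_def chain_rev by (rule chain_ochain)

lemma chain_tochain_iff:
  "adj G v x \<Longrightarrow> vdegree G v \<noteq> 2 \<Longrightarrow> chain G k (tochain v x) \<longleftrightarrow> k = clen v x"
  using chain_tochain[of v x] by (auto simp: chain_def)

lemma tochain_ends: "hd (tochain v x) = far v x" "last (tochain v x) = v"
  "rev (tochain v x) = v # ochain v x"
  by (simp_all add: tochain_def far_def hd_rev last_rev ochain_def)

text \<open>Every chain ending at \<open>v\<close> is determined by its last step, so quantifiers
  over vertex lists become quantifiers over neighbours of \<open>v\<close>.\<close>

lemma chains_to_eq: "vdegree G v \<noteq> 2 \<Longrightarrow> chains_to G v = tochain v ` nbrs G v"
proof (intro equalityI subsetI)
  fix p assume "p \<in> chains_to G v"
  then obtain k where k: "chain G k (rev p)" "last p = v" by (auto simp: chains_to_def chain_rev)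
  then have "p \<noteq> []" by (auto simp: chain_def)
  then obtain q where q: "rev p = v # q" using k(2) by (cases p rule: rev_cases) auto
  then have r: "run G v q" using k(1) chain_iff_run by simp
  then obtain x q' where x: "q = x # q'" by (cases q) auto
  then have "ochain v x = q" "adj G v x" using ochain_eq r by (auto simp: run_iff walk_iff)
  then have "p = tochain v x" using q by (metis rev_rev_ident tochain_def)
  then show "p \<in> tochain v ` nbrs G v" using \<open>adj G v x\<close> mem_nbrs by blast
next
  fix p assume "vdegree G v \<noteq> 2" "p \<in> tochain v ` nbrs G v"
  then obtain x where "p = tochain v x" "chain G (clen v x) p"
    using chain_tochain by (auto simp: mem_nbrs)
  then show "p \<in> chains_to G v" using tochain_ends(2) by (auto simp: chains_to_def)
qed

lemma inj_tochain: "tochain v x = tochain v y \<longleftrightarrow> x = y"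
  by (auto simp: tochain_def ochain_def)

lemma far_deg: "adj G v x \<Longrightarrow> vdegree G (far v x) \<noteq> 2"
  using run_ochain[of v x] by (auto simp: run_iff far_def)

lemma ochain_step:
  assumes "adj G v x"
  shows "vdegree G x \<noteq> 2 \<Longrightarrow> ochain v x = [x]"
    and "vdegree G x = 2 \<Longrightarrow> adj G x z \<Longrightarrow> z \<noteq> v \<Longrightarrow> ochain v x = x # ochain x z"
proof -
  assume "vdegree G x \<noteq> 2"
  then show "ochain v x = [x]" using assms by (intro ochain_eq) simp
next
  assume "vdegree G x = 2" "adj G x z" "z \<noteq> v"
  then have "run G v (x # ochain x z)" using assms run_ochain[of x z] by (simp add: ochain_def)
  then show "ochain v x = x # ochain x z" by (rule ochain_eq)
qed

lemma far_simps:
  assumes "adj G v x"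
  shows "vdegree G x \<noteq> 2 \<Longrightarrow> far v x = x \<and> entry v x = v \<and> clen v x = 0"
    and "vdegree G x = 2 \<Longrightarrow> adj G x z \<Longrightarrow> z \<noteq> v \<Longrightarrow>
      far v x = far x z \<and> entry v x = entry x z \<and> clen v x = Suc (clen x z)"
  using ochain_step[OF assms] by (auto simp: far_def entry_def clen_def ochain_def)

lemma
  assumes "adj G v x"
  shows adj_entry: "adj G (far v x) (entry v x)"
    and reverse_chain: "vdegree G v \<noteq> 2 \<Longrightarrow> tochain (far v x) (entry v x) = v # ochain v x"
proof -
  obtain q w where q: "ochain v x = q @ [w]" using hd_ochain(2)[of v x] by (metis rev_exhaust)
  define y where "y = last (v # q)"
  have fb: "far v x = w" "entry v x = y"
    unfolding far_def entry_def y_def using q by (simp_all add: butlast_append)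
  obtain q' where q': "v # q = q' @ [y]" unfolding y_def by (metis append_butlast_last_id list.simps(3))
  have "walk G ((v # q) @ [w])" using run_ochain[OF assms] q by (simp add: run_iff)
  then show a: "adj G (far v x) (entry v x)"
    unfolding fb q' by (simp add: walk_def successively_append_iff adj_sym)
  assume "vdegree G v \<noteq> 2"
  then have "chain G (clen v x) (rev (v # ochain v x))"
    using chain_ochain[OF assms] chain_rev by blast
  moreover have "rev (v # ochain v x) = w # y # rev q'"
    using q arg_cong[OF q', of rev] by simp
  ultimately have "run G w (y # rev q')" using chain_iff_run by simp
  then have "ochain w y = y # rev q'" by (rule ochain_eq)
  then show "tochain (far v x) (entry v x) = v # ochain v x"
    unfolding fb tochain_def using q q' by simp
qed

text \<open>Serves to switch between the orientations of a chain: (B1) and \<open>stops\<close> look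
  at a chain from one end, while weights and types are attached to the other.\<close>

lemma reverse_ends:
  assumes "adj G v x" "vdegree G v \<noteq> 2"
  shows "far (far v x) (entry v x) = v" "entry (far v x) (entry v x) = x"
    "clen (far v x) (entry v x) = clen v x"
proof -
  define w e where "w = far v x" and "e = entry v x"
  have *: "w # ochain w e = rev (ochain v x) @ [v]"
    using reverse_chain[OF assms] unfolding w_def e_def tochain_def
    by (metis rev.simps(2) rev_rev_ident)
  have "last (w # ochain w e) = v" unfolding * by simp
  then show "far (far v x) (entry v x) = v"
    unfolding w_def[symmetric] e_def[symmetric] far_def[of w e] using hd_ochain(2)[of w e] by simp
  have "length (w # ochain w e) = length (v # ochain v x)" unfolding * by simp
  then show "clen (far v x) (entry v x) = clen v x"
    unfolding w_def[symmetric] e_def[symmetric] clen_def by simp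
  have "last (butlast (w # ochain w e)) = x" unfolding * using hd_ochain by (simp add: last_rev)
  then show "entry (far v x) (entry v x) = x"
    unfolding w_def[symmetric] e_def[symmetric] entry_def[of w e] .
qed

lemma chain_path: "adj G v x \<Longrightarrow> path G (v # ochain v x)"
  using run_ochain by (simp add: run_iff path_iff)

section \<open>Paths towards a root\<close>

definition root_path :: "'a \<Rightarrow> 'a \<Rightarrow> 'a list" where
  "root_path u x = (THE p. path G p \<and> hd p = x \<and> last p = u)"

lemma path_ends_unique:
  assumes "path G p" "path G q" "hd p = hd q" "last p = last q" shows "p = q"
proof -
  have "p \<noteq> []" "q \<noteq> []" using assms by (auto simp: path_def walk_def)
  then have "p = butlast p @ [last p]" "q = butlast q @ [last p]"
    using append_butlast_last_id assms(4) by metis+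
  then show ?thesis using path_unique assms by metis
qed

lemma root_path_eq: "path G p \<Longrightarrow> root_path (last p) (hd p) = p"
  unfolding root_path_def using path_ends_unique by blast

lemma root_path:
  assumes "u \<in> verts G" "x \<in> verts G"
  shows "path G (root_path u x)" "hd (root_path u x) = x" "last (root_path u x) = u"
proof -
  obtain p where p: "path G p" "hd p = x" "last p = u" using path_ex[OF assms(2,1)] by blast
  then have "root_path u x = p" using root_path_eq by blast
  then show "path G (root_path u x)" "hd (root_path u x) = x" "last (root_path u x) = u" using p by simp_all
qed

lemma root_path_self: "u \<in> verts G \<Longrightarrow> root_path u u = [u]"
  using root_path_eq[of "[u]"] by (simp add: path_def walk_def)

text \<open>Prepending \<open>y\<close> to the path from \<open>x\<close> gives a path unless that
  path already continues with \<open>y\<close>. The two alternatives say which end of the edge is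
  the parent of the other.\<close>

lemma root_path_adj:
  assumes "u \<in> verts G" "adj G x y"
  shows "root_path u y = y # root_path u x \<or> root_path u x = x # root_path u y"
proof -
  have x: "x \<in> verts G" using assms adj_verts by blast
  note r = root_path[OF assms(1) x]
  obtain p where p: "root_path u x = x # p" using r by (cases "root_path u x") (auto simp: path_def walk_def)
  show ?thesis
  proof (cases "p \<noteq> [] \<and> hd p = y")
    case True
    then have "path G p" using r(1) unfolding p by (auto simp: path_def walk_def successively_Cons)
    then have "root_path u y = p" using root_path_eq[of p] True r(3) p by auto
    then show ?thesis using p by simp
  next
    case False
    have "path G (y # x # p)"
      using path_append[of "[y]" x p] path_edge[of y x] assms(2) adj_sym r(1) p False by auto
    then show ?thesis using root_path_eq[of "y # x # p"] r(3) p by auto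
  qed
qed

section \<open>Labelings in terms of neighbourhoods\<close>

lemma no_triangle:
  assumes "adj G x z" "adj G z y" "x \<noteq> y" shows "\<not> adj G x y"
proof
  assume "adj G x y"
  moreover have "path G [x, z, y]"
    using path_extend[of "[]" x z y] path_edge assms by simp
  ultimately have "graph_cycle G [x, z, y]"
    using adj_sym by (simp add: graph_cycle_def)
  then show False using tree by (auto simp: tree_def)
qed

text \<open>Without triangles, distinct vertices with a common neighbour are not adjacent;
  conversely a shortest walk with two edges has such a neighbour in the middle.\<close>

lemma gdist_2_iff: "gdist G x y = 2 \<longleftrightarrow> x \<noteq> y \<and> (\<exists>z. adj G x z \<and> adj G z y)"
proof
  let ?W = "{p. walk G p \<and> hd p = x \<and> last p = y}"
  have ge: "gdist G x y \<ge> 2" if "x \<noteq> y" "\<not> adj G x y"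
    unfolding gdist_def
  proof (rule INF_greatest)
    fix p assume p: "p \<in> ?W"
    then have "length p \<noteq> 0" "length p \<noteq> 1" "length p \<noteq> 2" using that
      by (auto simp: walk_def length_Suc_conv numeral_2_eq_2)
    then have "2 \<le> length p - 1" by linarith
    then show "2 \<le> enat (length p - 1)"
      by (metis enat_ord_simps(1) numeral_eq_enat)
  qed
  {
    assume d: "gdist G x y = 2"
    have short: "p \<notin> ?W" if "length p \<le> 2" for p
    proof
      assume "p \<in> ?W"
      then have "gdist G x y \<le> enat (length p - 1)" unfolding gdist_def by (rule INF_lower)
      also have "\<dots> \<le> enat 1" using that by simp
      finally show False using d by (simp add: numeral_eq_enat)
    qed
    have "gdist G x y < 3" using d by (simp add: numeral_eq_enat)
    then obtain p where p: "p \<in> ?W" "enat (length p - 1) < 3"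
      unfolding gdist_def INF_less_iff by blast
    then have "length p = 3" using short[of p] by (fastforce simp: numeral_eq_enat)
    then obtain a z b where "p = [a, z, b]" by (auto simp: length_Suc_conv numeral_3_eq_3)
    then have z: "adj G x z" "adj G z y" using p(1) by (auto simp: walk_def)
    moreover have "x \<noteq> y" using short[of "[x]"] z adj_verts by (auto simp: walk_def)
    ultimately show "x \<noteq> y \<and> (\<exists>z. adj G x z \<and> adj G z y)" by blast
  next
    assume "x \<noteq> y \<and> (\<exists>z. adj G x z \<and> adj G z y)"
    then obtain z where z: "x \<noteq> y" "adj G x z" "adj G z y" by blast
    then have "[x, z, y] \<in> ?W" using adj_verts by (auto simp: walk_def)
    then have "gdist G x y \<le> enat (length [x, z, y] - 1)" unfolding gdist_def by (rule INF_lower)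
    then have "gdist G x y \<le> 2" by (simp add: numeral_eq_enat numeral_2_eq_2)
    then show "gdist G x y = 2" using ge[OF z(1) no_triangle[OF z(2,3,1)]] by (rule order_antisym)
  }
qed

lemma L21_labeling_iff:
  "L21_labeling G f \<longleftrightarrow>
     (\<forall>x y. adj G x y \<longrightarrow> sep (f x) (f y)) \<and>
     (\<forall>z x y. adj G z x \<longrightarrow> adj G z y \<longrightarrow> x \<noteq> y \<longrightarrow> f x \<noteq> f y)"
proof -
  have "\<bar>int a - int b\<bar> \<ge> 2 \<longleftrightarrow> sep a b" for a b unfolding sep_def by linarith
  then show ?thesis
    unfolding L21_labeling_def gdist_2_iff using adj_verts adj_sym by meson
qed

end

section \<open>Weights and types\<close>

lemma insert2_eqD:
  "{e, y', z'} = {e, y, z} \<Longrightarrow> distinct [e, y', z'] \<Longrightarrow> distinct [e, y, z] \<Longrightarrow>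
    y' = y \<and> z' = z \<or> y' = z \<and> z' = y"
  by (simp add: insert_ident doubleton_eq_iff)

locale subcubic_tree = finite_tree +
  assumes max_deg: "max_degree G = 3" and two_majors: "card {v. major G v} \<ge> 2"
begin

lemma vdegree_le: "v \<in> verts G \<Longrightarrow> vdegree G v \<le> 3"
  using simple(1) max_deg by (metis Max_ge finite_imageI imageI max_degree_def)

lemma vdegree_pos: "adj G v x \<Longrightarrow> vdegree G v > 0"
  using finite_nbrs[of v] mem_nbrs[of x v] by (auto simp: vdegree_nbrs card_gt_0_iff)

lemma leaf_or_major: "adj G v x \<Longrightarrow> vdegree G v \<noteq> 2 \<Longrightarrow> leaf G v \<or> major G v"
  using vdegree_pos[of v x] vdegree_le[of v] adj_verts[of v x]
  by (auto simp: leaf_def major_def)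

lemma not_leaf_major: "leaf G v \<Longrightarrow> \<not> major G v"
  by (simp add: leaf_def major_def)

lemma major_vdegree: "major G v \<Longrightarrow> vdegree G v = 3 \<and> vdegree G v \<noteq> 2"
  by (simp add: major_def)

lemma far_cases: "adj G v x \<Longrightarrow> leaf G (far v x) \<or> major G (far v x)"
  using adj_entry far_deg leaf_or_major by blast

lemma major_nbrs:
  assumes "major G v" shows "\<exists>x y z. nbrs G v = {x, y, z} \<and> distinct [x, y, z]"
  using assms by (auto simp: major_def vdegree_nbrs card_3_iff)

lemma major_nbrs_eq:
  assumes "major G v" "adj G v x" "adj G v y" "adj G v z" "distinct [x, y, z]"
  shows "nbrs G v = {x, y, z}"
proof -
  have "{x, y, z} \<subseteq> nbrs G v" "card {x, y, z} = 3" using assms by (auto simp: mem_nbrs)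
  then show ?thesis using assms(1) finite_nbrs
    by (metis card_subset_eq major_def vdegree_nbrs)
qed

lemma major_nbrs_other:
  assumes "major G v" "adj G v x" shows "\<exists>y z. nbrs G v = {x, y, z} \<and> distinct [x, y, z]"
proof -
  obtain a b c where "nbrs G v = {a, b, c}" "distinct [a, b, c]" using major_nbrs assms(1) by blast
  moreover from this have "x \<in> {a, b, c}" using assms(2) mem_nbrs by blast
  ultimately show ?thesis by (auto; metis insert_commute)
qed

lemma ochain_end: "\<exists>r. v # ochain v x = r @ [entry v x, far v x]"
proof -
  have "v # ochain v x = butlast (v # ochain v x) @ [far v x]"
    using append_butlast_last_id[of "v # ochain v x"] by (simp add: far_def ochain_def)
  moreover have "butlast (v # ochain v x) = butlast (butlast (v # ochain v x)) @ [entry v x]"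
    using append_butlast_last_id[of "butlast (v # ochain v x)"] by (simp add: entry_def ochain_def)
  ultimately have "v # ochain v x = butlast (butlast (v # ochain v x)) @ [entry v x, far v x]"
    by (metis append.assoc append_Cons append_Nil)
  then show ?thesis by blast
qed

text \<open>The recursion behind the weights: it passes to the chains beyond the far end. It is
  well-founded because the way walked so far, collected in \<open>q\<close>, is extended to a longer
  path at each step.\<close>

lemma chain_induct [consumes 2, case_names step]:
  assumes "major G v" "adj G v x"
    and step: "\<And>v x. major G v \<Longrightarrow> adj G v x \<Longrightarrow>
      (\<And>y. major G (far v x) \<Longrightarrow> adj G (far v x) y \<Longrightarrow> y \<noteq> entry v x \<Longrightarrow> P (far v x) y) \<Longrightarrow> P v x"
  shows "P v x"
proof -
  have "path G (q @ [v, x]) \<Longrightarrow> major G v \<Longrightarrow> P v x" for q v x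
  proof (induction "card (verts G) - length q" arbitrary: q v x rule: less_induct)
    case less
    have a: "adj G v x" "path G (q @ [v])" "q \<noteq> [] \<Longrightarrow> last q \<noteq> x"
      using less.prems by (auto simp: path_def walk_def successively_append_iff)
    have p: "path G (q @ v # ochain v x)"
      using a chain_path hd_ochain by (intro path_append[of q v "ochain v x"]) auto
    obtain r where r: "v # ochain v x = r @ [entry v x, far v x]" using ochain_end by blast
    show ?case
    proof (rule step[OF less.prems(2) a(1)])
      fix y assume y: "major G (far v x)" "adj G (far v x) y" "y \<noteq> entry v x"
      have p': "path G ((q @ r @ [entry v x]) @ [far v x, y])"
        using path_extend[of "q @ r" "entry v x" "far v x" y] p y unfolding r by simp
      have "card (verts G) - length (q @ r @ [entry v x]) < card (verts G) - length q"
        using path_length[OF p'] by simp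
      then show "P (far v x) y" using less.hyps[OF _ p'] y by blast
    qed
  qed
  from this[of "[]"] show ?thesis using path_edge assms by simp
qed

section \<open>Weights as functions of a vertex and a neighbour\<close>

lemma closed_tochain_iff:
  "major G v \<Longrightarrow> adj G v x \<Longrightarrow> closed_chain G k (tochain v x) \<longleftrightarrow> major G (far v x) \<and> k = clen v x"
  using major_vdegree by (auto simp: closed_chain_def tochain_ends chain_tochain_iff)

lemma open_tochain_iff:
  "major G v \<Longrightarrow> adj G v x \<Longrightarrow> open_chain G k (tochain v x) \<longleftrightarrow> leaf G (far v x) \<and> k = clen v x"
  using major_vdegree not_leaf_major by (auto simp: open_chain_def tochain_ends chain_tochain_iff)

text \<open>The list \<open>rev p\<close> in the rule for types is the chain through
  \<open>entry v x\<close> at the far end, so the two other chains there are given by the two other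
  neighbours.\<close>

lemma has_type_iff:
  assumes "major G v" "adj G v x"
  shows "has_type G (tochain v x) c k \<longleftrightarrow>
    major G (far v x) \<and> k = clen v x \<and> k \<ge> 2 \<and>
    (\<exists>y z a b. adj G (far v x) y \<and> adj G (far v x) z \<and> distinct [entry v x, y, z] \<and>
       gives_weight G (tochain (far v x) y) a \<and> gives_weight G (tochain (far v x) z) b \<and>
       c = type_of_weights a b)" (is "_ \<longleftrightarrow> ?R")
proof
  have r: "rev (tochain v x) = tochain (far v x) (entry v x)"
    using reverse_chain assms major_vdegree by (simp add: tochain_ends)
  {
    assume "has_type G (tochain v x) c k"
    then show ?R
    proof (cases rule: has_type.cases)
      case (type_closed q r a b)
      then have m: "major G (far v x)" "k = clen v x" using closed_tochain_iff assms by auto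
      then have "q \<in> tochain (far v x) ` nbrs G (far v x)" "r \<in> tochain (far v x) ` nbrs G (far v x)"
        using type_closed chains_to_eq[of "far v x"] major_vdegree by (auto simp: tochain_ends)
      then obtain y z where "q = tochain (far v x) y" "adj G (far v x) y"
        "r = tochain (far v x) z" "adj G (far v x) z" by (auto simp: mem_nbrs)
      moreover from this have "distinct [entry v x, y, z]" using type_closed r by auto
      ultimately show ?thesis using m type_closed by blast
    qed
  next
    assume ?R
    then obtain y z a b where *: "major G (far v x)" "k = clen v x" "k \<ge> 2" "adj G (far v x) y"
      "adj G (far v x) z" "distinct [entry v x, y, z]" "gives_weight G (tochain (far v x) y) a"
      "gives_weight G (tochain (far v x) z) b" "c = type_of_weights a b" by blast
    have "closed_chain G k (tochain v x)" using closed_tochain_iff assms * by simp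
    moreover have "tochain (far v x) y \<in> chains_to G (hd (tochain v x))"
      "tochain (far v x) z \<in> chains_to G (hd (tochain v x))"
      using chains_to_eq[of "far v x"] * major_vdegree by (auto simp: tochain_ends mem_nbrs)
    ultimately show "has_type G (tochain v x) c k"
      unfolding \<open>c = _\<close> using * r by (intro type_closed) (auto simp: inj_tochain)
  }
qed

lemma gives_weight_iff:
  assumes "major G v" "adj G v x"
  shows "gives_weight G (tochain v x) a \<longleftrightarrow>
    (if leaf G (far v x) then a = 1 else if clen v x = 0 then a = 6 else if clen v x = 1 then a = 15
     else \<exists>c. has_type G (tochain v x) c (clen v x) \<and> a = weight_of_type c (clen v x))" (is "_ \<longleftrightarrow> ?R")
proof
  assume "gives_weight G (tochain v x) a"
  then show ?R
  proof (cases rule: gives_weight.cases)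
    case (weight_open k)
    then show ?thesis using open_tochain_iff[OF assms] by simp
  next
    case weight_closed_0
    then show ?thesis using closed_tochain_iff[OF assms, of 0] not_leaf_major[of "far v x"] by auto
  next
    case weight_closed_1
    then show ?thesis using closed_tochain_iff[OF assms, of 1] not_leaf_major[of "far v x"] by auto
  next
    case (weight_closed c k)
    have "major G (far v x)" and k: "k = clen v x" "k \<ge> 2"
      using iffD1[OF has_type_iff[OF assms] weight_closed(2)] by simp_all
    then have "\<not> leaf G (far v x)" using not_leaf_major by blast
    moreover have "\<exists>c. has_type G (tochain v x) c (clen v x) \<and> a = weight_of_type c (clen v x)"
      using weight_closed k(1) by (intro exI[of _ c]) simp
    moreover have "clen v x \<noteq> 0" "clen v x \<noteq> 1" using k by simp_all
    ultimately show ?thesis by simp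
  qed
next
  have "closed_chain G (clen v x) (tochain v x)" if "\<not> leaf G (far v x)"
    using closed_tochain_iff far_cases that assms by blast
  moreover have "open_chain G (clen v x) (tochain v x)" if "leaf G (far v x)"
    using open_tochain_iff that assms by blast
  moreover assume R: ?R
  ultimately consider "open_chain G (clen v x) (tochain v x)" "a = 1"
    | "closed_chain G 0 (tochain v x)" "a = 6" | "closed_chain G 1 (tochain v x)" "a = 15"
    | c where "has_type G (tochain v x) c (clen v x)" "a = weight_of_type c (clen v x)"
    by (metis (full_types))
  then show "gives_weight G (tochain v x) a"
  proof cases
    case 1
    then show ?thesis using assms(1) tochain_ends(2) by (metis weight_open)
  next
    case 2
    then show ?thesis by (simp only: weight_closed_0)
  next
    case 3
    then show ?thesis by (simp only: weight_closed_1)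
  next
    case 4
    then show ?thesis by (simp only: weight_closed)
  qed
qed

text \<open>Existence and uniqueness follow the recursion. The two chains beyond the far end may be
  taken in either order because \<open>type_of_weights\<close> is symmetric on
  \<open>weights\<close>.\<close>

lemma gives_weight_unique:
  assumes "major G v" "adj G v x"
  shows "\<exists>!a. gives_weight G (tochain v x) a \<and> a \<in> set weights"
    and "gives_weight G (tochain v x) a \<Longrightarrow> a \<in> set weights"
proof -
  have "(\<exists>a. gives_weight G (tochain v x) a) \<and>
    (\<forall>a b. gives_weight G (tochain v x) a \<longrightarrow> gives_weight G (tochain v x) b \<longrightarrow> a = b \<and> a \<in> set weights)"
    using assms
  proof (induction rule: chain_induct)
    case (step v x)
    show ?case
    proof (cases "leaf G (far v x) \<or> clen v x < 2")
      case True
      then have "gives_weight G (tochain v x) a \<longleftrightarrow>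
          a = (if leaf G (far v x) then 1 else if clen v x = 0 then 6 else 15)" for a
        using gives_weight_iff[OF step.hyps] by auto
      then show ?thesis by (simp add: weights_def)
    next
      case False
      then have m: "major G (far v x)" using far_cases step.hyps by blast
      obtain y z where yz: "nbrs G (far v x) = {entry v x, y, z}" "distinct [entry v x, y, z]"
        using major_nbrs_other[OF m adj_entry[OF step.hyps(2)]] by blast
      then have adj: "adj G (far v x) y" "adj G (far v x) z" by (auto simp flip: mem_nbrs)
      then obtain a b where a: "gives_weight G (tochain (far v x) y) a"
        and b: "gives_weight G (tochain (far v x) z) b"
        using step.IH[OF m adj(1)] step.IH[OF m adj(2)] yz(2) by auto
      have au: "a' = a" "a \<in> set weights" if "gives_weight G (tochain (far v x) y) a'" for a'
        using step.IH[OF m adj(1)] yz(2) a that by auto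
      have bu: "b' = b" "b \<in> set weights" if "gives_weight G (tochain (far v x) z) b'" for b'
        using step.IH[OF m adj(2)] yz(2) b that by auto
      have "has_type G (tochain v x) c (clen v x) \<longleftrightarrow> c = type_of_weights a b" for c
      proof
        assume "has_type G (tochain v x) c (clen v x)"
        then obtain y' z' a' b' where *: "adj G (far v x) y'" "adj G (far v x) z'"
          "distinct [entry v x, y', z']" "gives_weight G (tochain (far v x) y') a'"
          "gives_weight G (tochain (far v x) z') b'" "c = type_of_weights a' b'"
          using has_type_iff[OF step.hyps] by blast
        then have "nbrs G (far v x) = {entry v x, y', z'}"
          using major_nbrs_eq[OF m adj_entry[OF step.hyps(2)]] by blast
        then have "y' = y \<and> z' = z \<or> y' = z \<and> z' = y" using yz * insert2_eqD by metis
        then show "c = type_of_weights a b"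
          using * au(1) bu(1) type_of_weights_commute[OF au(2)[OF a] bu(2)[OF b]] by metis
      next
        assume "c = type_of_weights a b"
        then show "has_type G (tochain v x) c (clen v x)"
          using has_type_iff[OF step.hyps] m False adj yz(2) a b by force
      qed
      then show ?thesis using gives_weight_iff[OF step.hyps] False weight_of_type_mem by auto
    qed
  qed
  then show "\<exists>!a. gives_weight G (tochain v x) a \<and> a \<in> set weights"
    and "gives_weight G (tochain v x) a \<Longrightarrow> a \<in> set weights" by blast+
qed

definition weight :: "'a \<Rightarrow> 'a \<Rightarrow> nat" where
  "weight v x = (THE a. gives_weight G (tochain v x) a)"

lemma
  assumes "major G v" "adj G v x"
  shows gives_weight_eq: "gives_weight G (tochain v x) a \<longleftrightarrow> a = weight v x"
    and weight_mem: "weight v x \<in> set weights"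
proof -
  have ex1: "\<exists>!a. gives_weight G (tochain v x) a" using gives_weight_unique[OF assms] by blast
  show *: "gives_weight G (tochain v x) a \<longleftrightarrow> a = weight v x" for a
    unfolding weight_def using ex1 the1_equality[OF ex1] theI'[OF ex1] by blast
  show "weight v x \<in> set weights" using * gives_weight_unique(2)[OF assms] by blast
qed

text \<open>The type of the chain from \<open>far v x\<close> to \<open>v\<close>, here without a restriction on its length or on
  the degree of \<open>v\<close>.\<close>

definition ctype :: "'a \<Rightarrow> 'a \<Rightarrow> nat" where
  "ctype v x = (THE c. \<exists>y z. nbrs G (far v x) = {entry v x, y, z} \<and> distinct [entry v x, y, z] \<and>
     c = type_of_weights (weight (far v x) y) (weight (far v x) z))"

lemma ctype_eq:
  assumes "major G (far v x)" "nbrs G (far v x) = {entry v x, y, z}" "distinct [entry v x, y, z]"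
  shows "ctype v x = type_of_weights (weight (far v x) y) (weight (far v x) z)"
proof -
  have w: "weight (far v x) y \<in> set weights" "weight (far v x) z \<in> set weights"
    using assms by (auto intro!: weight_mem simp flip: mem_nbrs)
  show ?thesis unfolding ctype_def
  proof (rule the_equality)
    fix c assume "\<exists>y z. nbrs G (far v x) = {entry v x, y, z} \<and> distinct [entry v x, y, z] \<and>
     c = type_of_weights (weight (far v x) y) (weight (far v x) z)"
    then obtain y' z' where "nbrs G (far v x) = {entry v x, y', z'}" "distinct [entry v x, y', z']"
     and c: "c = type_of_weights (weight (far v x) y') (weight (far v x) z')" by blast
    then have "y' = y \<and> z' = z \<or> y' = z \<and> z' = y" using assms insert2_eqD by metis
    then show "c = type_of_weights (weight (far v x) y) (weight (far v x) z)"
      using c type_of_weights_commute[OF w] by auto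
  qed (use assms in blast)
qed

lemma ctype_ex:
  assumes "major G (far v x)" "adj G v x"
  obtains y z where "nbrs G (far v x) = {entry v x, y, z}" "distinct [entry v x, y, z]"
    "adj G (far v x) y" "adj G (far v x) z"
    "ctype v x = type_of_weights (weight (far v x) y) (weight (far v x) z)"
proof -
  obtain y z where yz: "nbrs G (far v x) = {entry v x, y, z}" "distinct [entry v x, y, z]"
    using major_nbrs_other[OF assms(1) adj_entry[OF assms(2)]] by blast
  then have "adj G (far v x) y" "adj G (far v x) z" by (auto simp flip: mem_nbrs)
  then show ?thesis using that yz ctype_eq[OF assms(1) yz] by blast
qed

lemma has_type_eq:
  assumes "major G v" "adj G v x"
  shows "has_type G (tochain v x) c k \<longleftrightarrow>
    major G (far v x) \<and> k = clen v x \<and> k \<ge> 2 \<and> c = ctype v x"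
proof -
  have "(\<exists>y z a b. adj G (far v x) y \<and> adj G (far v x) z \<and> distinct [entry v x, y, z] \<and>
       gives_weight G (tochain (far v x) y) a \<and> gives_weight G (tochain (far v x) z) b \<and>
       c = type_of_weights a b) \<longleftrightarrow> c = ctype v x" if m: "major G (far v x)"
  proof
    assume "c = ctype v x"
    then show "\<exists>y z a b. adj G (far v x) y \<and> adj G (far v x) z \<and> distinct [entry v x, y, z] \<and>
       gives_weight G (tochain (far v x) y) a \<and> gives_weight G (tochain (far v x) z) b \<and>
       c = type_of_weights a b"
      using ctype_ex[OF m assms(2)] gives_weight_eq[OF m] by metis
  next
    assume "\<exists>y z a b. adj G (far v x) y \<and> adj G (far v x) z \<and> distinct [entry v x, y, z] \<and>
       gives_weight G (tochain (far v x) y) a \<and> gives_weight G (tochain (far v x) z) b \<and>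
       c = type_of_weights a b"
    then obtain y z where yz: "adj G (far v x) y" "adj G (far v x) z" "distinct [entry v x, y, z]"
       and c: "c = type_of_weights (weight (far v x) y) (weight (far v x) z)"
      by (auto simp: gives_weight_eq[OF m])
    show "c = ctype v x"
      unfolding c using ctype_eq[OF m major_nbrs_eq[OF m adj_entry[OF assms(2)] yz] yz(3)] by simp
  qed
  then show ?thesis unfolding has_type_iff[OF assms] by blast
qed

lemma weight_rec:
  assumes "major G v" "adj G v x"
  shows "weight v x = (if leaf G (far v x) then 1 else if clen v x = 0 then 6
    else if clen v x = 1 then 15 else weight_of_type (ctype v x) (clen v x))"
proof -
  have "gives_weight G (tochain v x) (if leaf G (far v x) then 1 else if clen v x = 0 then 6
    else if clen v x = 1 then 15 else weight_of_type (ctype v x) (clen v x))"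
    unfolding gives_weight_iff[OF assms] has_type_eq[OF assms]
    using far_cases[OF assms(2)] by auto
  then show ?thesis using gives_weight_eq[OF assms] by auto
qed

lemma ctype_mem:
  assumes "major G (far v x)" "adj G v x" shows "ctype v x \<in> set weights"
  by (rule ctype_ex[OF assms]) (simp only: type_of_weights_mem weight_mem assms)

text \<open>The disjuncts are (B1), (B2) and (B3) for one ordering of the neighbours of
  \<open>u\<close>. In (B1) the chain leaves \<open>u\<close> through \<open>x\<close>, so its type
  comes from the other two weights at \<open>u\<close>.\<close>

definition bad_at :: "'a \<Rightarrow> 'a \<Rightarrow> 'a \<Rightarrow> 'a \<Rightarrow> bool" where
  "bad_at u x y z \<longleftrightarrow>
     major G (far u x) \<and> clen u x = 3 \<and> type_of_weights (weight u y) (weight u z) = 2 \<or>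
     weight u x = weight u y \<and> weight u x \<in> {6, 10, 15} \<or>
     weight u x > 0 \<and> weight u y > 0 \<and> weight u z > 0 \<and>
       gcd (weight u x) (gcd (weight u y) (weight u z)) > 1"

lemma bad_vertex_iff:
  "bad_vertex G u \<longleftrightarrow>
     major G u \<and> (\<exists>x y z. nbrs G u = {x, y, z} \<and> distinct [x, y, z] \<and> bad_at u x y z)"
proof (intro iffI conjI)
  assume bad: "bad_vertex G u"
  then show u: "major G u" by (simp add: bad_vertex_def)
  have ch: "chains_to G u = tochain u ` nbrs G u" using chains_to_eq u major_vdegree by simp
  consider "B1 G u" | "B2 G u" | "B3 G u" using bad by (auto simp: bad_vertex_def)
  then show "\<exists>x y z. nbrs G u = {x, y, z} \<and> distinct [x, y, z] \<and> bad_at u x y z"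
  proof cases
    case 1
    then obtain p k where p: "closed_chain G k p" "hd p = u" "has_type G p 2 3"
      by (auto simp: B1_def)
    then have "rev p \<in> chains_to G u"
      using chain_rev by (auto simp: chains_to_def closed_chain_def chain_def last_rev)
    then obtain x where x: "adj G u x" "rev p = tochain u x" using ch by (auto simp: mem_nbrs)
    \<comment> \<open>The chain of (B1) leads away from \<open>u\<close>, so it is addressed from
      its far end.\<close>
    then have px: "p = tochain (far u x) (entry u x)"
      using reverse_chain[of u x] u major_vdegree tochain_ends(3) by (metis rev_rev_ident)
    have "last p = far u x" using x(2) tochain_ends(1) by (metis hd_rev)
    then have m: "major G (far u x)" using p(1) by (simp add: closed_chain_def)
    note re = reverse_ends[OF x(1)]
    have t: "ctype (far u x) (entry u x) = 2" "clen u x = 3"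
      using p(3) unfolding px using has_type_eq[OF m adj_entry[OF x(1)]] re u major_vdegree by auto
    obtain y z where yz: "nbrs G u = {x, y, z}" "distinct [x, y, z]"
      using major_nbrs_other u x by blast
    then have "ctype (far u x) (entry u x) = type_of_weights (weight u y) (weight u z)"
      using ctype_eq[of "far u x" "entry u x" y z] re u major_vdegree by simp
    then show ?thesis using t yz m unfolding bad_at_def by metis
  next
    case 2
    then obtain x y where xy: "x \<noteq> y" "adj G u x" "adj G u y" "weight u x = weight u y"
      "weight u x \<in> {6,10,15}"
      unfolding B2_def ch by (auto simp: mem_nbrs gives_weight_eq[OF u] inj_tochain)
    obtain a b where ab: "nbrs G u = {x, a, b}" "distinct [x, a, b]"
      using major_nbrs_other[OF u xy(2)] by blast
    then have "y = a \<or> y = b" using xy(1,3) mem_nbrs[of y u] by auto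
    then obtain z where "nbrs G u = {x, y, z}" "distinct [x, y, z]"
      using ab that by (auto simp: insert_commute)
    then show ?thesis using xy unfolding bad_at_def by blast
  next
    case 3
    then obtain x y z where xyz: "adj G u x" "adj G u y" "adj G u z" "distinct [x, y, z]"
      "weight u x > 0 \<and> weight u y > 0 \<and> weight u z > 0 \<and>
       gcd (weight u x) (gcd (weight u y) (weight u z)) > 1"
      unfolding B3_def ch by (auto simp: mem_nbrs gives_weight_eq[OF u] inj_tochain)
    then show ?thesis using major_nbrs_eq[OF u] unfolding bad_at_def by blast
  qed
next
  assume "major G u \<and> (\<exists>x y z. nbrs G u = {x, y, z} \<and> distinct [x, y, z] \<and> bad_at u x y z)"
  then obtain x y z where u: "major G u" and xyz: "nbrs G u = {x, y, z}" "distinct [x, y, z]"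
    and b: "bad_at u x y z" by blast
  have ch: "chains_to G u = tochain u ` nbrs G u" using chains_to_eq u major_vdegree by simp
  have adj: "adj G u x" "adj G u y" "adj G u z" using xyz(1) by (auto simp flip: mem_nbrs)
  note g = gives_weight_eq[OF u]
  from b consider "major G (far u x)" "clen u x = 3" "type_of_weights (weight u y) (weight u z) = 2"
    | "weight u x = weight u y" "weight u x \<in> {6, 10, 15}"
    | "weight u x > 0" "weight u y > 0" "weight u z > 0"
       "gcd (weight u x) (gcd (weight u y) (weight u z)) > 1" by (auto simp: bad_at_def)
  then show "bad_vertex G u"
  proof cases
    case 1
    note re = reverse_ends[OF adj(1)]
    have "ctype (far u x) (entry u x) = type_of_weights (weight u y) (weight u z)"
      using ctype_eq[of "far u x" "entry u x" y z] re u major_vdegree xyz by simp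
    then have "has_type G (tochain (far u x) (entry u x)) 2 3"
      using has_type_eq[OF 1(1) adj_entry[OF adj(1)]] re u major_vdegree 1 by auto
    moreover have "closed_chain G 3 (tochain (far u x) (entry u x))"
      using closed_tochain_iff[OF 1(1) adj_entry[OF adj(1)]] re u major_vdegree 1 by auto
    moreover have "hd (tochain (far u x) (entry u x)) = u"
      using re u major_vdegree by (simp add: tochain_ends)
    ultimately show ?thesis using u unfolding bad_vertex_def B1_def by blast
  next
    case 2
    have "B2 G u" unfolding B2_def ch xyz(1)
      by (rule bexI[of _ "tochain u x"], rule bexI[of _ "tochain u y"], rule bexI[of _ "weight u x"])
        (use 2 xyz(2) adj g in \<open>auto simp: inj_tochain\<close>)
    then show ?thesis using u unfolding bad_vertex_def by blast
  next
    case 3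
    have "B3 G u" unfolding B3_def ch xyz(1)
      by (rule bexI[of _ "tochain u x"], rule bexI[of _ "tochain u y"], rule bexI[of _ "tochain u z"],
          rule exI[of _ "weight u x"], rule exI[of _ "weight u y"], rule exI[of _ "weight u z"])
        (use 3 xyz(2) adj g in \<open>auto simp: inj_tochain\<close>)
    then show ?thesis using u unfolding bad_vertex_def by blast
  qed
qed

section \<open>Labelings respect the weights\<close>

lemma major_ex: "\<exists>v. major G v"
  using two_majors by (metis Collect_empty_eq card.empty not_numeral_le_zero)

text \<open>Among 0 to 4 only 0 and 4 have three compatible labels, namely 2, 3, 4 and 0, 1,
  2.\<close>

lemma three_labels:
  assumes "L21_labeling G f" "\<forall>x\<in>verts G. f x \<le> 4" "major G v" "adj G v x"
  shows "(f v = 0 \<or> f v = 4) \<and> rel_label (f v) (f x) \<in> {2,3,4}"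
proof -
  obtain y z where yz: "nbrs G v = {x, y, z}" "distinct [x, y, z]" using major_nbrs_other assms by blast
  then have a: "adj G v x" "adj G v y" "adj G v z" by (auto simp flip: mem_nbrs)
  then have "sep (f v) (f x)" "sep (f v) (f y)" "sep (f v) (f z)"
    and d: "f x \<noteq> f y" "f y \<noteq> f z" "f x \<noteq> f z" and le: "f v \<le> 4" "f x \<le> 4" "f y \<le> 4" "f z \<le> 4"
    using yz(2) assms(1,2) adj_verts unfolding L21_labeling_iff by auto
  then have "f v = 0 \<or> f v = 4" unfolding sep_def by linarith
  then show ?thesis using \<open>sep (f v) (f x)\<close> le by (auto simp: sep_def rel_label_def)
qed

lemma lambda_number_4:
  "lambda_number G = 4 \<longleftrightarrow> (\<exists>f. L21_labeling G f \<and> (\<forall>x\<in>verts G. f x \<le> 4))"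
proof -
  let ?P = "\<lambda>k. \<exists>f. L21_labeling G f \<and> (\<forall>x\<in>verts G. f x \<le> k)"
  \<comment> \<open>Doubling an injective numbering of the vertices gives a labeling, so the
    \<open>LEAST\<close> is attained.\<close>
  obtain g :: "'a \<Rightarrow> nat" and n where g: "g ` verts G = {i. i < n}" "inj_on g (verts G)"
    using finite_imp_inj_to_nat_seg[OF simple(1)] by blast
  have "x \<in> verts G \<Longrightarrow> y \<in> verts G \<Longrightarrow> x \<noteq> y \<Longrightarrow> g x \<noteq> g y" for x y
    using g(2) by (auto dest: inj_onD)
  then have "g x \<noteq> g y" if "adj G z x \<and> adj G z y \<and> x \<noteq> y \<or> adj G x y" for x y z
    using that adj_verts adj_irrefl by metis
  then have "L21_labeling G (\<lambda>x. 2 * g x)"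
    unfolding L21_labeling_iff sep_def by (force simp: neq_iff)
  moreover have "\<forall>x\<in>verts G. g x < n" using g(1) by blast
  then have "\<forall>x\<in>verts G. 2 * g x \<le> 2 * n" by fastforce
  ultimately have ex: "?P (2 * n)" by blast
  \<comment> \<open>With labels at most 3 a major vertex is labeled 0 and its neighbours need 2, 3
    and 4.\<close>
  have no3: "\<not> ?P k" if "k \<le> 3" for k
  proof
    assume "?P k"
    then obtain f where f: "L21_labeling G f" "\<forall>x\<in>verts G. f x \<le> k" by blast
    then have f4: "\<forall>x\<in>verts G. f x \<le> 4" using that by fastforce
    obtain v where v: "major G v" using major_ex by blast
    then obtain x y z where n: "nbrs G v = {x, y, z}" "distinct [x, y, z]" using major_nbrs by blast
    then have a: "adj G v x" "adj G v y" "adj G v z" by (auto simp flip: mem_nbrs)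
    have "f x \<le> 3" "f y \<le> 3" "f z \<le> 3" "f v \<le> 3" using f that a adj_verts by (meson le_trans)+
    moreover have "f x \<noteq> f y" "f y \<noteq> f z" "f x \<noteq> f z"
      using f(1) n(2) a unfolding L21_labeling_iff by auto
    ultimately show False
      using three_labels[OF f(1) f4 v a(1)] three_labels[OF f(1) f4 v a(2)]
        three_labels[OF f(1) f4 v a(3)] by (auto simp: rel_label_def)
  qed
  show ?thesis
  proof
    assume "lambda_number G = 4"
    then show "?P 4" using LeastI[of ?P, OF ex] by (simp add: lambda_number_def)
  next
    assume "?P 4"
    then have "lambda_number G \<le> 4" "?P (lambda_number G)"
      unfolding lambda_number_def by (rule Least_le, rule LeastI)
    then have "\<not> lambda_number G \<le> 3" using no3 by blast
    then show "lambda_number G = 4" using \<open>lambda_number G \<le> 4\<close> by simp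
  qed
qed

lemma clen_0: "adj G v x \<Longrightarrow> clen v x = 0 \<Longrightarrow> vdegree G x \<noteq> 2 \<and> far v x = x \<and> entry v x = v"
  using far_simps[of v x] card_2_iff'[of "nbrs G x"] by (metis mem_nbrs nat.distinct(1) vdegree_nbrs)

lemma clen_Suc:
  assumes "adj G v x" "clen v x = Suc k"
  obtains z where "vdegree G x = 2" "nbrs G x = {v, z}" "z \<noteq> v" "adj G x z" "far v x = far x z"
    "entry v x = entry x z" "clen x z = k"
proof -
  have d: "vdegree G x = 2" using far_simps(1)[OF assms(1)] assms(2) by fastforce
  then obtain a b where "nbrs G x = {a, b}" "a \<noteq> b"
    using vdegree_nbrs[of x] by (auto simp: card_2_iff)
  moreover from this have "v = a \<or> v = b" using assms(1) adj_sym mem_nbrs[of v x] by auto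
  ultimately obtain z where z: "nbrs G x = {v, z}" "z \<noteq> v" by (metis insert_commute)
  then have "adj G x z" by (auto simp flip: mem_nbrs)
  then show ?thesis using that d z far_simps(2)[OF assms(1) d] assms(2) by auto
qed

lemma ctype_cong: "far v x = far w y \<Longrightarrow> entry v x = entry w y \<Longrightarrow> ctype v x = ctype w y"
  by (simp add: ctype_def)

text \<open>Induction from \<open>v\<close> along the chain: each of its inner vertices sees the
  same far end and entry, and each further edge is one transfer step.\<close>

lemma chain_labels_propagate:
  assumes f: "L21_labeling G f" "\<forall>x\<in>verts G. f x \<le> 4"
  shows "adj G v x \<Longrightarrow> (f (far v x), f (entry v x)) \<in> set (chain_labels c 0) \<Longrightarrow>
    (f x, f v) \<in> set (chain_labels c (clen v x))"
proof (induction "clen v x" arbitrary: v x)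
  case 0
  then show ?case using clen_0[of v x] by simp
next
  case (Suc k)
  obtain z where z: "nbrs G x = {v, z}" "z \<noteq> v" "adj G x z" "far v x = far x z"
    "entry v x = entry x z" "clen x z = k" using clen_Suc[OF Suc.prems(1)] Suc.hyps(2) by metis
  have "(f z, f x) \<in> set (chain_labels c k)"
    using Suc.hyps(1)[of x z] z Suc.prems(2) by simp
  moreover have "adj G x v" using Suc.prems adj_sym by blast
  moreover from this have "f z \<noteq> f v" "sep (f x) (f v)" "f x \<le> 4" "f v \<le> 4"
    using f z adj_verts unfolding L21_labeling_iff by blast+
  ultimately show ?case unfolding Suc.hyps(2)[symmetric] chain_labels_Suc by blast
qed

text \<open>By induction the neighbours of the far end beyond the chain carry labels left by their
  weights; hence the type admits the label at the entry, and the transfer brings this to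
  \<open>x\<close>. On a 0-chain \<open>x\<close> is itself major, so its label relative to
  \<open>v\<close> is 4.\<close>

lemma weight_labels_sound:
  assumes f: "L21_labeling G f" "\<forall>x\<in>verts G. f x \<le> 4" and "major G v" "adj G v x"
  shows "rel_label (f v) (f x) \<in> weight_labels (weight v x)"
  using assms(3,4)
proof (induction rule: chain_induct)
  case (step v x)
  note l = three_labels[OF f step.hyps] and w = weight_rec[OF step.hyps]
  have x: "f x \<le> 4" "sep (f v) (f x)"
    using f step.hyps adj_verts unfolding L21_labeling_iff by blast+
  consider "leaf G (far v x)" | "major G (far v x)" "clen v x = 0" | "major G (far v x)" "clen v x = 1"
    | "major G (far v x)" "clen v x \<ge> 2" using far_cases[OF step.hyps(2)] by linarith
  then show ?case
  proof cases
    case 1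
    then show ?thesis using w l label_constants by simp
  next
    case 2
    then have "\<not> leaf G (far v x)" "far v x = x" using not_leaf_major clen_0[OF step.hyps(2)] by blast+
    moreover from this have "f x = 0 \<or> f x = 4"
      using three_labels[OF f, of x v] 2 step.hyps(2) adj_sym by metis
    ultimately show ?thesis using w l 2 label_constants x by (auto simp: sep_def rel_label_def)
  next
    case 3
    then have nl: "\<not> leaf G (far v x)" using not_leaf_major by blast
    obtain z where z: "nbrs G x = {v, z}" "z \<noteq> v" "adj G x z" "far v x = far x z" "clen x z = 0"
      using clen_Suc[OF step.hyps(2)] 3(2) by (metis One_nat_def)
    then have "far v x = z" using clen_0 by metis
    then have "f z = 0 \<or> f z = 4"
      using three_labels[OF f, of z x] 3 z(3) adj_sym by metis
    moreover have "f z \<noteq> f v" "sep (f x) (f z)"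
      using z f(1) step.hyps(2) adj_sym unfolding L21_labeling_iff by metis+
    \<comment> \<open>The major vertices on the two sides of \<open>x\<close> carry 0 and 4, which
      leaves only 2 between them.\<close>
    ultimately have "f x = 2" using l x by (auto simp: sep_def)
    then show ?thesis using w nl 3 label_constants l by (auto simp: rel_label_def)
  next
    case 4
    then have nl: "\<not> leaf G (far v x)" using not_leaf_major by blast
    let ?w = "far v x" and ?e = "entry v x"
    obtain y z where yz: "nbrs G ?w = {?e, y, z}" "distinct [?e, y, z]" "adj G ?w y" "adj G ?w z"
      "ctype v x = type_of_weights (weight ?w y) (weight ?w z)" using ctype_ex[OF 4(1) step.hyps(2)] .
    note e = adj_entry[OF step.hyps(2)]
    have w3: "f ?w = 0 \<or> f ?w = 4" "rel_label (f ?w) (f ?e) \<in> {2,3,4}"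
      using three_labels[OF f 4(1) e] by blast+
    have "rel_label (f ?w) (f y) \<in> weight_labels (weight ?w y)"
      "rel_label (f ?w) (f z) \<in> weight_labels (weight ?w z)"
      using step.IH[OF 4(1)] yz by auto
    moreover have "f ?e \<le> 4" "f y \<le> 4" "f z \<le> 4" "f y \<noteq> f z" "f y \<noteq> f ?e" "f z \<noteq> f ?e"
      "sep (f ?w) (f ?e)"
      using f yz e adj_verts unfolding L21_labeling_iff by auto
    moreover from this have "distinct [rel_label (f ?w) (f y), rel_label (f ?w) (f z), rel_label (f ?w) (f ?e)]"
      by (auto simp: rel_label_def)
    ultimately have "rel_label (f ?w) (f ?e) \<in> type_labels (ctype v x)"
      unfolding yz(5) using type_of_weights_labels[OF weight_mem weight_mem, OF 4(1) yz(3) 4(1) yz(4)]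
        w3(2) by auto
    then have "(f ?w, f ?e) \<in> set (chain_labels (ctype v x) 0)"
      using w3(1) \<open>f ?e \<le> 4\<close> \<open>sep (f ?w) (f ?e)\<close> unfolding chain_labels_0 by blast
    then have "(f x, f v) \<in> set (chain_labels (ctype v x) (clen v x))"
      using chain_labels_propagate[OF f step.hyps(2)] by blast
    moreover have "weight v x = weight_of_type (ctype v x) (clen v x)" using w nl 4(2) by simp
    ultimately show ?thesis
      using chain_labels_weight[OF ctype_mem[OF 4(1) step.hyps(2)] 4(2)] l x(1) by simp
  qed
qed

text \<open>Under (B1) the far end receives weight 0, so no label is left there. Under (B2) two
  neighbours have the same single label left. Under (B3) one label is excluded at all three
  neighbours, which together carry 2, 3 and 4.\<close>

lemma bad_vertex_not_labelable:
  assumes f: "L21_labeling G f" "\<forall>x\<in>verts G. f x \<le> 4"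
  shows "\<not> bad_vertex G u"
proof
  assume "bad_vertex G u"
  then obtain x y z where u: "major G u" and xyz: "nbrs G u = {x, y, z}" "distinct [x, y, z]"
    and b: "bad_at u x y z" using bad_vertex_iff by blast
  have a: "adj G u x" "adj G u y" "adj G u z" using xyz(1) by (auto simp flip: mem_nbrs)
  note w = weight_labels_sound[OF f u]
  have l: "rel_label (f u) (f v) \<in> {2,3,4}" if "adj G u v" for v using three_labels[OF f u] that by blast
  have "f x \<le> 4" "f y \<le> 4" "f z \<le> 4" "f x \<noteq> f y" "f y \<noteq> f z" "f x \<noteq> f z"
    using f xyz(2) a adj_verts unfolding L21_labeling_iff by auto
  then have d: "distinct [rel_label (f u) (f x), rel_label (f u) (f y), rel_label (f u) (f z)]"
    by (auto simp: rel_label_def)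
  from b consider "major G (far u x)" "clen u x = 3" "type_of_weights (weight u y) (weight u z) = 2"
    | "weight u x = weight u y" "weight u x \<in> {6, 10, 15}"
    | "gcd (weight u x) (gcd (weight u y) (weight u z)) > 1" by (auto simp: bad_at_def)
  then show False
  proof cases
    case 1
    let ?w = "far u x" and ?e = "entry u x"
    have re: "far ?w ?e = u" "entry ?w ?e = x" "clen ?w ?e = 3"
      using reverse_ends[OF a(1)] u major_vdegree 1(2) by auto
    have "ctype ?w ?e = 2"
      using ctype_eq[of ?w ?e y z] re u xyz 1(3) by simp
    moreover have "\<not> leaf G u" using u not_leaf_major by blast
    ultimately have "weight ?w ?e = 0"
      using weight_rec[OF 1(1) adj_entry[OF a(1)]] re by (simp add: weight_of_type_def)
    then show False
      using weight_labels_sound[OF f 1(1) adj_entry[OF a(1)]] by (simp add: weight_labels_def)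
  next
    case 2
    then show False using w[OF a(1)] w[OF a(2)] d by (auto simp: label_constants)
  next
    case 3
    let ?g = "gcd (weight u x) (gcd (weight u y) (weight u z))"
    have "{rel_label (f u) (f x), rel_label (f u) (f y), rel_label (f u) (f z)} = {2,3,4}"
      using l[OF a(1)] l[OF a(2)] l[OF a(3)] d by auto
    moreover have "\<exists>n\<in>{2,3,4}. n \<notin> weight_labels (weight u x) \<and> n \<notin> weight_labels (weight u y) \<and>
      n \<notin> weight_labels (weight u z)"
      using common_excluded_label[unfolded list_all_iff, THEN bspec, OF weight_mem[OF u a(1)],
          THEN bspec, OF weight_mem[OF u a(2)], THEN bspec, OF weight_mem[OF u a(3)]] 3 by blast
    ultimately obtain n where "n \<in> {rel_label (f u) (f x), rel_label (f u) (f y), rel_label (f u) (f z)}"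
      "n \<notin> weight_labels (weight u x)" "n \<notin> weight_labels (weight u y)"
      "n \<notin> weight_labels (weight u z)" by blast
    then show False using w[OF a(1)] w[OF a(2)] w[OF a(3)] by auto
  qed
qed

section \<open>Labelings of trees without bad vertices\<close>

text \<open>If the weights beyond the far end are positive, a zero weight can only come from type 0,
  which is (B2) at the far end, or from type (2,3), which is (B1) there.\<close>

lemma weight_pos:
  assumes good: "\<And>u. \<not> bad_vertex G u" and "major G v" "adj G v x"
  shows "weight v x > 0"
  using assms(2,3)
proof (induction rule: chain_induct)
  case (step v x)
  show ?case
  proof (cases "leaf G (far v x) \<or> clen v x < 2")
    case True
    then show ?thesis using weight_rec[OF step.hyps] by auto
  next
    case False
    let ?w = "far v x" and ?e = "entry v x"
    have m: "major G ?w" using far_cases step.hyps(2) False by blast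
    obtain y z where yz: "nbrs G ?w = {?e, y, z}" "distinct [?e, y, z]" "adj G ?w y" "adj G ?w z"
      "ctype v x = type_of_weights (weight ?w y) (weight ?w z)" using ctype_ex[OF m step.hyps(2)] .
    note wm = weight_mem[OF m yz(3)] weight_mem[OF m yz(4)]
    have nb: "\<not> bad_at ?w ?e y z" "\<not> bad_at ?w y z ?e"
      using good[of ?w] bad_vertex_iff m yz(1,2) by (auto simp: insert_commute)
    have re: "far ?w ?e = v" "clen ?w ?e = clen v x"
      using reverse_ends[OF step.hyps(2)] step.hyps(1) major_vdegree by auto
    have pos: "weight ?w y \<noteq> 0" "weight ?w z \<noteq> 0" using step.IH[OF m] yz(2-4) by auto
    have "weight v x = weight_of_type (ctype v x) (clen v x)"
      using weight_rec[OF step.hyps] False by simp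
    moreover have "weight_of_type (ctype v x) (clen v x) \<noteq> 0"
    proof
      assume "weight_of_type (ctype v x) (clen v x) = 0"
      then consider "ctype v x = 0" | "ctype v x = 2" "clen v x = 3"
        using weight_of_type_eq_0[OF ctype_mem[OF m step.hyps(2)]] False by (metis not_less)
      then show False
      proof cases
        case 1
        then show False using type_of_weights_0[OF wm] yz(5) pos nb(2) by (auto simp: bad_at_def)
      next
        case 2
        then show False using nb(1) re step.hyps(1) yz(5) by (auto simp: bad_at_def)
      qed
    qed
    ultimately show ?thesis by simp
  qed
qed

text \<open>For positive weights the failure of (B2) and (B3) is Hall's condition: no two label sets
  are the same singleton, and the three sets together cover 2, 3 and 4.\<close>

lemma distinct_weight_labels:
  assumes good: "\<And>u. \<not> bad_vertex G u" and w: "major G w" "nbrs G w = {x, y, z}" "distinct [x, y, z]"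
  shows "\<exists>a\<in>weight_labels (weight w x). \<exists>b\<in>weight_labels (weight w y).
    \<exists>c\<in>weight_labels (weight w z). distinct [a, b, c]"
proof -
  have a: "adj G w x" "adj G w y" "adj G w z" using w(2) by (auto simp flip: mem_nbrs)
  have "\<not> bad_at w x y z" "\<not> bad_at w x z y" "\<not> bad_at w y z x"
    using good[of w] bad_vertex_iff w by (auto simp: insert_commute)
  moreover have "weight w x > 0" "weight w y > 0" "weight w z > 0" using weight_pos[OF good w(1)] a by auto
  moreover from this have "gcd (weight w x) (gcd (weight w y) (weight w z)) > 0" by simp
  ultimately have "gcd (weight w x) (gcd (weight w y) (weight w z)) = 1"
    and "weight w x = weight w y \<Longrightarrow> weight w x \<notin> {6,10,15}"
    and "weight w x = weight w z \<Longrightarrow> weight w x \<notin> {6,10,15}"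
    and "weight w y = weight w z \<Longrightarrow> weight w y \<notin> {6,10,15}"
    unfolding bad_at_def by (linarith | blast)+
  then show ?thesis
    using weight_mem[OF w(1)] weight_pos[OF good w(1)] a by (intro distinct_labels_ex) simp_all
qed

text \<open>Converse of \<open>weight_labels_sound\<close> along one chain. For
  \<open>k \<ge> 2\<close> it is the certified table. The weights 6 and 15 of shorter chains ignore
  what lies beyond the far end; there a choice of distinct labels at the far end, which is not bad,
  shows that its type admits the forced label 4 or 2.\<close>

lemma weight_labels_complete:
  assumes good: "\<And>u. \<not> bad_vertex G u" and v: "major G v" "adj G v x" "major G (far v x)"
    and l: "i = 0 \<or> i = 4" "rel_label i j \<in> weight_labels (weight v x)" "j \<le> 4"
  shows "(j, i) \<in> set (chain_labels (ctype v x) (clen v x))"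
proof -
  let ?w = "far v x" and ?e = "entry v x"
  have nl: "\<not> leaf G ?w" "\<not> leaf G v" using v not_leaf_major by blast+
  obtain y z where yz: "nbrs G ?w = {?e, y, z}" "distinct [?e, y, z]" "adj G ?w y" "adj G ?w z"
    "ctype v x = type_of_weights (weight ?w y) (weight ?w z)" using ctype_ex[OF v(3) v(2)] .
  have re: "far ?w ?e = v" "clen ?w ?e = clen v x"
    using reverse_ends[OF v(2)] v(1) major_vdegree by auto
  have "nbrs G ?w = {y, z, ?e}" "distinct [y, z, ?e]" using yz by auto
  then obtain a b c where abc: "a \<in> weight_labels (weight ?w y)" "b \<in> weight_labels (weight ?w z)"
    "c \<in> weight_labels (weight ?w ?e)" "distinct [a, b, c]"
    using distinct_weight_labels[OF good v(3)] by blast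
  moreover have "c \<in> {2,3,4}" using abc(3) by (auto simp: weight_labels_def split: if_splits)
  ultimately have c: "c \<in> type_labels (ctype v x)"
    unfolding yz(5) using type_of_weights_labels[OF weight_mem weight_mem, OF v(3) yz(3) v(3) yz(4)]
    by auto
  note w = weight_rec[OF v(1,2)] and w' = weight_rec[OF v(3) adj_entry[OF v(2)]]
  have s: "sep i j" using l by (auto simp: weight_labels_def sep_def rel_label_def split: if_splits)
  consider "clen v x = 0" | "clen v x = 1" | "clen v x \<ge> 2" by linarith
  then show ?thesis
  proof cases
    case 1
    then have "c = 4" "rel_label i j = 4" using w w' nl re abc(3) l(2) label_constants by auto
    then show ?thesis using c l s 1 unfolding 1 chain_labels_0 by (auto simp: rel_label_def sep_def)
  next
    case 2
    then have "c = 2" "rel_label i j = 2" using w w' nl re abc(3) l(2) label_constants by auto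
    then have "j = 2" using l by (auto simp: rel_label_def)
    \<comment> \<open>On a 1-chain the far end must carry the extreme label opposite to
      \<open>i\<close>.\<close>
    then have "(4 - i, j) \<in> set (chain_labels (ctype v x) 0)" "4 - i \<noteq> i" "i \<le> 4"
      using c l \<open>c = 2\<close> unfolding chain_labels_0 by (auto simp: rel_label_def sep_def)
    moreover have "sep j i" using s sep_sym by blast
    ultimately show ?thesis using l(3) unfolding 2 One_nat_def chain_labels_Suc by blast
  next
    case 3
    then have "weight v x = weight_of_type (ctype v x) (clen v x)" using w nl by simp
    then show ?thesis using chain_labels_weight[OF ctype_mem[OF v(3,2)] 3 l(1,3)] s l(2) by simp
  qed
qed

text \<open>The invariant of the labeling that grows from a root: \<open>v\<close> has label \<open>i\<close>, its child \<open>x\<close> has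
  label \<open>j\<close>, and the rest of the chain through \<open>x\<close> can still be labeled.\<close>

definition fits :: "'a \<Rightarrow> 'a \<Rightarrow> nat \<Rightarrow> nat \<Rightarrow> bool" where
  "fits v x i j \<longleftrightarrow> adj G v x \<and> sep i j \<and> i \<le> 4 \<and> j \<le> 4 \<and>
     (major G (far v x) \<longrightarrow> (j, i) \<in> set (chain_labels (ctype v x) (clen v x)))"

lemma fits_major:
  assumes good: "\<And>u. \<not> bad_vertex G u" and "major G v" "adj G v x" "i = 0 \<or> i = 4"
    "n \<in> weight_labels (weight v x)"
  shows "fits v x i (rel_label i n)"
proof -
  have n: "n \<in> {2,3,4}" using assms(5) by (auto simp: weight_labels_def split: if_splits)
  then have "rel_label i (rel_label i n) = n" "sep i (rel_label i n)" "rel_label i n \<le> 4" "i \<le> 4"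
    using assms(4) by (auto simp: rel_label_def sep_def)
  then show ?thesis unfolding fits_def
    using weight_labels_complete[OF good assms(2,3) _ assms(4)] assms(3,5) by simp
qed

text \<open>A leaf has no child. At degree 2 the last transfer step is undone; if the chain ends in
  a leaf, any compatible label will do. At a major vertex the type admits the label of
  \<open>v\<close>, which means that distinct labels remain for the two children.\<close>

lemma fits_step:
  assumes good: "\<And>u. \<not> bad_vertex G u" and "fits v x i j"
  shows "\<exists>g. inj_on g (nbrs G x - {v}) \<and> (\<forall>z\<in>nbrs G x - {v}. fits x z j (g z) \<and> g z \<noteq> i)"
proof -
  have vx: "adj G v x" "adj G x v" "sep i j" "i \<le> 4" "j \<le> 4"
    and ch: "major G (far v x) \<Longrightarrow> (j, i) \<in> set (chain_labels (ctype v x) (clen v x))"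
    using assms(2) adj_sym by (auto simp: fits_def)
  consider "leaf G x" | "vdegree G x = 2" | "major G x" using leaf_or_major vx(2) by blast
  then show ?thesis
  proof cases
    case 1
    then have "card (nbrs G x) = 1" by (simp add: leaf_def vdegree_nbrs)
    then have "nbrs G x - {v} = {}" using vx(2) mem_nbrs[of v x] by (auto simp: card_1_singleton_iff)
    then show ?thesis by (metis empty_iff inj_on_empty)
  next
    case 2
    then obtain k where "clen v x = Suc k"
      by (metis card_2_iff' far_simps(2) mem_nbrs vdegree_nbrs vx(1))
    then obtain z where z: "nbrs G x = {v, z}" "z \<noteq> v" "adj G x z" "far v x = far x z"
      "entry v x = entry x z" "clen x z = k" using clen_Suc[OF vx(1)] by metis
    have "\<exists>h. fits x z j h \<and> h \<noteq> i"
    proof (cases "major G (far v x)")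
      case True
      then obtain h where "(h, j) \<in> set (chain_labels (ctype v x) k)" "h \<noteq> i"
        using ch \<open>clen v x = Suc k\<close> unfolding chain_labels_Suc by (metis chain_labels_Suc)
      then show ?thesis
        using chain_labels_edge[of h j] z ctype_cong[OF z(4,5)] sep_sym by (auto simp: fits_def)
    next
      case False
      then show ?thesis using edge_label_extend[OF vx(3,5)] z vx(5) by (auto simp: fits_def)
    qed
    then obtain h where "fits x z j h" "h \<noteq> i" by blast
    then show ?thesis using z(1,2) by (intro exI[of _ "\<lambda>_. h"]) auto
  next
    case 3
    then have f: "far v x = x" "entry v x = v" "clen v x = 0"
      using far_simps(1)[OF vx(1)] major_vdegree by auto
    obtain y z where yz: "nbrs G x = {v, y, z}" "distinct [v, y, z]" "adj G x y" "adj G x z"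
      "ctype v x = type_of_weights (weight x y) (weight x z)"
      using ctype_ex[of v x] 3 vx(1) unfolding f by blast
    have c: "j = 0 \<or> j = 4" "rel_label j i \<in> type_labels (ctype v x)"
      using ch 3 unfolding f chain_labels_0 by auto
    then obtain p q where pq: "p \<in> weight_labels (weight x y)" "q \<in> weight_labels (weight x z)"
      "distinct [p, q, rel_label j i]"
      unfolding yz(5) type_of_weights_labels[OF weight_mem[OF 3 yz(3)] weight_mem[OF 3 yz(4)]] by auto
    have "fits x y j (rel_label j p)" "fits x z j (rel_label j q)"
      using fits_major[OF good 3 yz(3) c(1) pq(1)] fits_major[OF good 3 yz(4) c(1) pq(2)] .
    moreover have "p \<le> 4" "q \<le> 4" using pq by (auto simp: weight_labels_def split: if_splits)
    then have "distinct [rel_label j p, rel_label j q, i]" using pq(3) vx(4) by (auto simp: rel_label_def)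
    ultimately show ?thesis using yz(1,2)
      by (intro exI[of _ "\<lambda>t. if t = y then rel_label j p else rel_label j q"]) (auto simp: inj_on_def)
  qed
qed

lemma fits_root:
  assumes good: "\<And>u. \<not> bad_vertex G u" and "major G u"
  shows "\<exists>g. inj_on g (nbrs G u) \<and> (\<forall>z\<in>nbrs G u. fits u z 0 (g z))"
proof -
  obtain x y z where xyz: "nbrs G u = {x, y, z}" "distinct [x, y, z]" using major_nbrs assms(2) by blast
  then have a: "adj G u x" "adj G u y" "adj G u z" by (auto simp flip: mem_nbrs)
  obtain p q r where pqr: "p \<in> weight_labels (weight u x)" "q \<in> weight_labels (weight u y)"
    "r \<in> weight_labels (weight u z)" "distinct [p, q, r]"
    using distinct_weight_labels[OF good assms(2) xyz] by blast
  note f = fits_major[OF good assms(2), of _ 0]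
  have "fits u x 0 p" "fits u y 0 q" "fits u z 0 r"
    using f[OF a(1) _ pqr(1)] f[OF a(2) _ pqr(2)] f[OF a(3) _ pqr(3)] by (simp_all add: rel_label_def)
  then show ?thesis using xyz pqr(4)
    by (intro exI[of _ "\<lambda>t. if t = x then p else if t = y then q else r"]) (auto simp: inj_on_def)
qed

text \<open>The choices from \<open>fits_root\<close> and \<open>fits_step\<close> label every path
  that leads to the root, hence every vertex through its unique such path.\<close>

lemma good_labelable:
  assumes good: "\<And>u. \<not> bad_vertex G u"
  shows "\<exists>f. L21_labeling G f \<and> (\<forall>x\<in>verts G. f x \<le> 4)"
proof -
  obtain u where u: "major G u" "u \<in> verts G" using major_ex by (auto simp: major_def)
  obtain g0 where g0: "inj_on g0 (nbrs G u)" "\<And>z. adj G u z \<Longrightarrow> fits u z 0 (g0 z)"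
    using fits_root[OF good u(1)] mem_nbrs by blast
  obtain g where g: "\<And>v x i j. fits v x i j \<Longrightarrow> inj_on (g v x i j) (nbrs G x - {v}) \<and>
     (\<forall>z\<in>nbrs G x - {v}. fits x z j (g v x i j z) \<and> g v x i j z \<noteq> i)"
    using fits_step[OF good] by metis
  \<comment> \<open>On \<open>[u]\<close> the default value 0 of \<open>path_label\<close> is the
    label of the root.\<close>
  define L where "L = path_label g0 g"
  have fits: "fits v x (L (v # r)) (L (x # v # r))" if "path G (x # v # r)" "last (v # r) = u" for x v r
    using that
  proof (induction r arbitrary: x v)
    case Nil
    then show ?case using g0(2) adj_sym by (auto simp: L_def path_def walk_def)
  next
    case (Cons w r)
    then have "fits w v (L (w # r)) (L (v # w # r))" by (auto simp: path_def walk_def)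
    moreover have "x \<in> nbrs G v - {w}" using Cons.prems adj_sym by (auto simp: path_def walk_def mem_nbrs)
    ultimately show ?case using g by (simp add: L_def)
  qed
  define f where "f x = L (root_path u x)" for x
  note P = root_path[OF u(2)]
  have edge: "fits x y (f x) (f y)" if "adj G x y" "root_path u y = y # root_path u x" for x y
  proof -
    have "x \<in> verts G" "y \<in> verts G" using that adj_verts by blast+
    then obtain r where r: "root_path u x = x # r"
      using P[of x] by (cases "root_path u x") (auto simp: path_def walk_def)
    then show ?thesis using fits[of y x r] P[of x] P[of y] that \<open>x \<in> verts G\<close> \<open>y \<in> verts G\<close>
      by (auto simp: f_def)
  qed
  \<comment> \<open>Two neighbours of \<open>z\<close> are a child and the parent of
    \<open>z\<close>, or two children of \<open>z\<close>.\<close>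
  have grand: "f x \<noteq> f y" if "adj G z x" "adj G z y" "root_path u x = x # root_path u z"
    "root_path u z = z # root_path u y" "x \<noteq> y" for x y z
  proof -
    have "x \<in> verts G" "y \<in> verts G" using that adj_verts by blast+
    then obtain r where r: "root_path u y = y # r"
      using P[of y] by (cases "root_path u y") (auto simp: path_def walk_def)
    have "fits y z (f y) (f z)" using edge that adj_sym by blast
    moreover have "x \<in> nbrs G z - {y}" using that by (simp add: mem_nbrs)
    moreover have "f x = g y z (f y) (f z) x" using that r by (simp add: f_def L_def)
    ultimately show ?thesis using g by metis
  qed
  have siblings: "f x \<noteq> f y" if "adj G z x" "adj G z y" "root_path u x = x # root_path u z"
    "root_path u y = y # root_path u z" "x \<noteq> y" for x y z
  proof -
    have v: "x \<in> verts G" "y \<in> verts G" "z \<in> verts G" using that adj_verts by blast+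
    then obtain r where r: "root_path u z = z # r"
      using P[of z] by (cases "root_path u z") (auto simp: path_def walk_def)
    show ?thesis
    proof (cases r)
      case Nil
      then have "z = u" using P[of z] r v by simp
      then show ?thesis using that g0(1) r Nil by (auto simp: f_def L_def mem_nbrs dest: inj_onD)
    next
      case (Cons w s)
      have "w \<noteq> x" "w \<noteq> y" using P[of x] P[of y] v that r Cons by (auto simp: path_def)
      then have "x \<in> nbrs G z - {w}" "y \<in> nbrs G z - {w}" using that by (auto simp: mem_nbrs)
      moreover have "fits w z (L (w # s)) (L (z # w # s))"
        using fits P[of z] v r Cons by simp
      ultimately have "g w z (L (w # s)) (L (z # w # s)) x \<noteq> g w z (L (w # s)) (L (z # w # s)) y"
        using g that(5) by (metis inj_onD)
      then show ?thesis using that r Cons by (simp add: f_def L_def)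
    qed
  qed
  have "sep (f x) (f y) \<and> f x \<le> 4" if "adj G x y" for x y
    using root_path_adj[OF u(2) that] edge[of x y] edge[of y x] that adj_sym sep_sym
    unfolding fits_def by blast
  moreover have "f x \<noteq> f y" if "adj G z x" "adj G z y" "x \<noteq> y" for x y z
  proof -
    have "x \<in> verts G" "y \<in> verts G" using that adj_verts by blast+
    then have "root_path u x \<noteq> root_path u y" using P that(3) by metis
    then show ?thesis
      using root_path_adj[OF u(2) that(1)] root_path_adj[OF u(2) that(2)]
        grand[of z x y] grand[of z y x] siblings[of z x y] that by (metis list.inject)
  qed
  ultimately have "L21_labeling G f" "\<And>x y. adj G x y \<Longrightarrow> f x \<le> 4"
    unfolding L21_labeling_iff by blast+
  \<comment> \<open>The bound on the labels is known at ends of edges; every vertex is one.\<close>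
  moreover have "\<exists>y. adj G x y" if x: "x \<in> verts G" for x
  proof (cases "x = u")
    case True
    then show ?thesis using major_nbrs[OF u(1)] mem_nbrs by blast
  next
    case False
    then obtain y r where "root_path u x = x # y # r"
      using P[OF x] by (cases "root_path u x" rule: remdups_adj.cases) (auto simp: path_def walk_def)
    then show ?thesis using P(1)[OF x] by (auto simp: path_def walk_def)
  qed
  ultimately show ?thesis by blast
qed

section \<open>Bad strong subtrees\<close>

text \<open>\<open>y\<close> is the neighbour of \<open>x\<close> in the direction of the root.\<close>

definition stops :: "'a \<Rightarrow> 'a \<Rightarrow> bool" where
  "stops y x \<longleftrightarrow> major G x \<and> major G (far x y) \<and>
     (clen x y \<le> 1 \<or> ctype (far x y) (entry x y) = 1)"

text \<open>The last two arguments are parent and child. Stopping is tested only at vertices with a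
  parent, so the root keeps all its neighbours.\<close>

inductive grown :: "'a \<Rightarrow> 'a \<Rightarrow> 'a \<Rightarrow> bool" for u where
  root: "adj G u x \<Longrightarrow> grown u u x"
| step: "grown u y x \<Longrightarrow> \<not> stops y x \<Longrightarrow> adj G x z \<Longrightarrow> z \<noteq> y \<Longrightarrow> grown u x z"

definition grown_tree :: "'a \<Rightarrow> 'a ugraph" where
  "grown_tree u = \<lparr>verts = insert u {x. \<exists>y. grown u y x}, edges = {{y, x} |y x. grown u y x}\<rparr>"

end

locale rooted_subcubic_tree = subcubic_tree +
  fixes u :: 'a
  assumes major_u: "major G u"
begin

section \<open>The grown subgraph is a tree\<close>

abbreviation "S \<equiv> grown_tree u"

lemma u_verts: "u \<in> verts G" using major_u by (simp add: major_def)

text \<open>Growth never returns to the parent, so each step lengthens the path to the root by one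
  vertex.\<close>

lemma grown_path: "grown u y x \<Longrightarrow> adj G y x \<and> root_path u x = x # root_path u y"
proof (induction rule: grown.induct)
  case (root x)
  have "root_path u u \<noteq> u # root_path u x"
    using root_path(1)[OF u_verts, of x] adj_verts root root_path_self[OF u_verts]
    by (auto simp: path_def walk_def)
  then show ?case using root_path_adj[OF u_verts root] root by auto
next
  case (step y x z)
  then have "y \<in> verts G" "z \<in> verts G" using adj_verts by blast+
  then have "root_path u z \<noteq> root_path u y" using root_path(2)[OF u_verts] step.hyps(4) by metis
  then show ?case using root_path_adj[OF u_verts step.hyps(3)] step by auto
qed

lemma grown_adj: "grown u y x \<Longrightarrow> adj G y x" "grown u y x \<Longrightarrow> adj G x y"
  using grown_path adj_sym by blast+

lemma grown_parent_unique:
  assumes "grown u y x" "grown u y' x" shows "y = y'"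
proof -
  have "root_path u y = root_path u y'" using grown_path[OF assms(1)] grown_path[OF assms(2)] by simp
  then show ?thesis using root_path(2)[OF u_verts] grown_adj[OF assms(1)] grown_adj[OF assms(2)] adj_verts
    by metis
qed

lemma not_grown_root: "\<not> grown u y u"
proof
  assume g: "grown u y u"
  then have "root_path u y \<noteq> []" using root_path(1)[OF u_verts] grown_adj adj_verts
    by (metis path_def walk_def)
  then show False using grown_path[OF g] root_path_self[OF u_verts] by simp
qed

lemma grown_asym:
  assumes "grown u y x" shows "\<not> grown u x y"
proof
  assume "grown u x y"
  then have "length (root_path u y) = Suc (length (root_path u x))" using grown_path by simp
  moreover have "length (root_path u x) = Suc (length (root_path u y))" using grown_path[OF assms] by simp
  ultimately show False by simp
qed

lemma grown_root_iff: "grown u u x \<longleftrightarrow> adj G u x"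
  using grown_adj grown.root by blast

lemma grown_step_iff:
  assumes "grown u y x" shows "grown u x z \<longleftrightarrow> \<not> stops y x \<and> adj G x z \<and> z \<noteq> y"
proof
  assume "grown u x z"
  then show "\<not> stops y x \<and> adj G x z \<and> z \<noteq> y"
  proof (cases rule: grown.cases)
    case root
    then show ?thesis using assms not_grown_root by blast
  next
    case (step y')
    then show ?thesis using assms grown_parent_unique by blast
  qed
qed (use assms grown.step in blast)

lemma adj_S: "adj S x z \<longleftrightarrow> grown u x z \<or> grown u z x"
  by (auto simp: adj_def grown_tree_def doubleton_eq_iff)

lemma adj_S_imp: "adj S x z \<Longrightarrow> adj G x z"
  using adj_S grown_adj by blast

lemma verts_S: "x \<in> verts S \<longleftrightarrow> x = u \<or> (\<exists>y. grown u y x)"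
  by (simp add: grown_tree_def)

lemma grown_source: "grown u y x \<Longrightarrow> y \<in> verts S"
  unfolding verts_S by (erule grown.cases) blast+

lemma verts_S_subset: "verts S \<subseteq> verts G"
proof
  fix x assume "x \<in> verts S"
  then show "x \<in> verts G" using verts_S[of x] u_verts grown_adj(1)[of _ x] adj_verts by auto
qed

lemma walk_S_imp: "walk S p \<Longrightarrow> walk G p"
  using verts_S_subset adj_S_imp by (auto simp: walk_def intro: successively_mono)

lemma walk_root_path: "x \<in> verts S \<Longrightarrow> walk S (root_path u x)"
proof -
  have "grown u y x \<Longrightarrow> walk S (root_path u x)" for y x
  proof (induction rule: grown.induct)
    case (root x)
    then have "grown u u x" by (rule grown.root)
    then show ?case using grown_path[of u x] root_path_self[OF u_verts] adj_S verts_S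
      by (auto simp: walk_def)
  next
    case (step y x z)
    have g: "grown u x z" using step.hyps by (rule grown.step)
    have "x \<in> verts G" using step.hyps(3) adj_verts by blast
    then have "hd (root_path u x) = x" using root_path(2)[OF u_verts] by blast
    moreover have "adj S z x" "z \<in> verts S" using g adj_S verts_S by blast+
    ultimately show ?case using step.IH grown_path[OF g] by (auto simp: walk_def successively_Cons)
  qed
  then show "x \<in> verts S \<Longrightarrow> walk S (root_path u x)"
    using verts_S root_path_self[OF u_verts] by (auto simp: walk_def)
qed

text \<open>Each vertex is joined to the root by its \<open>root_path\<close>, which stays in the
  subgraph; a cycle would be a cycle of the ambient tree.\<close>

lemma tree_S: "tree S"
  unfolding tree_def
proof (intro conjI)
  show "simple_graph S"
    unfolding simple_graph_def
  proof
    show "finite (verts S)" using verts_S_subset simple(1) finite_subset by blast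
    show "\<forall>e\<in>edges S. e \<subseteq> verts S \<and> card e = 2"
    proof
      fix e assume "e \<in> edges S"
      then obtain y x where "e = {y, x}" "grown u y x" by (auto simp: grown_tree_def)
      moreover from this have "y \<noteq> x" using grown_adj(1) adj_irrefl by metis
      ultimately show "e \<subseteq> verts S \<and> card e = 2" using grown_source verts_S by auto
    qed
  qed
  show "verts S \<noteq> {}" by (auto simp: grown_tree_def)
  show "graph_connected S"
    unfolding graph_connected_def
  proof (intro ballI)
    fix x y assume xy: "x \<in> verts S" "y \<in> verts S"
    then have v: "x \<in> verts G" "y \<in> verts G" using verts_S_subset by blast+
    note rx = root_path[OF u_verts v(1)] and ry = root_path[OF u_verts v(2)]
    have sym: "adj S a b \<longleftrightarrow> adj S b a" for a b using adj_S by blast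
    have "walk S (rev (root_path u y))"
      using walk_root_path[OF xy(2)] by (auto simp: walk_def sym)
    moreover obtain q where q: "rev (root_path u y) = u # q"
      using ry walk_root_path[OF xy(2)]
      by (cases "root_path u y" rule: rev_cases) (auto simp: walk_def)
    moreover obtain p where p: "root_path u x = p @ [u]"
      using rx walk_root_path[OF xy(1)]
      by (cases "root_path u x" rule: rev_cases) (auto simp: walk_def)
    ultimately have "walk S (p @ u # q)"
      using walk_root_path[OF xy(1)] by (auto simp: walk_def successively_append_iff)
    moreover have "hd (p @ u # q) = x" using rx(2) p by (cases p) auto
    moreover have "last (p @ u # q) = y" using ry(2) q by (metis hd_rev last_appendR list.distinct(1) rev_rev_ident)
    ultimately show "\<exists>p. path S p \<and> hd p = x \<and> last p = y" using walk_imp_path by metis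
  qed
  show "\<nexists>p. graph_cycle S p"
  proof
    assume "\<exists>p. graph_cycle S p"
    then obtain p where "graph_cycle S p" ..
    then have "graph_cycle G p" using walk_S_imp adj_S_imp by (auto simp: graph_cycle_def path_def)
    then show False using tree by (auto simp: tree_def)
  qed
qed

sublocale S: finite_tree S
  by unfold_locales (rule tree_S)

section \<open>Degrees and chains of the grown subtree\<close>

lemma nbrs_S_root: "nbrs S u = nbrs G u"
  using S.mem_nbrs mem_nbrs adj_S not_grown_root grown_root_iff by blast

lemma nbrs_S:
  assumes "grown u y x" shows "nbrs S x = (if stops y x then {y} else nbrs G x)"
proof -
  have "z \<in> nbrs S x \<longleftrightarrow> z = y \<or> \<not> stops y x \<and> z \<in> nbrs G x" for z
    unfolding S.mem_nbrs mem_nbrs adj_S grown_step_iff[OF assms]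
    using assms grown_parent_unique by blast
  moreover have "y \<in> nbrs G x" using mem_nbrs grown_adj(2)[OF assms] by blast
  ultimately show ?thesis by (cases "stops y x") auto
qed

lemma vdegree_S:
  "vdegree S u = 3"
  "grown u y x \<Longrightarrow> vdegree S x = (if stops y x then 1 else vdegree G x)"
  using nbrs_S_root major_u nbrs_S[of y x] by (auto simp: S.vdegree_nbrs vdegree_nbrs major_def)

text \<open>A vertex keeps all its neighbours or, if growth stops there, only its parent, and growth
  stops only at major vertices. This makes the subtree strong.\<close>

lemma vdegree_S_2: "x \<in> verts S \<Longrightarrow> vdegree S x = 2 \<longleftrightarrow> vdegree G x = 2"
proof -
  assume "x \<in> verts S"
  then consider "x = u" | y where "grown u y x" using verts_S by blast
  then show ?thesis
  proof cases
    case 1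
    then show ?thesis using vdegree_S(1) major_u by (simp add: major_def)
  next
    case (2 y)
    then show ?thesis using vdegree_S(2)[OF 2] major_vdegree[of x]
      by (cases "stops y x") (simp_all add: stops_def)
  qed
qed

lemma major_S_root: "major S u"
  using vdegree_S verts_S by (simp add: major_def)

lemma major_S:
  assumes "major S w" shows "major G w \<and> (grown u y w \<longrightarrow> \<not> stops y w)"
proof (cases "w = u")
  case True
  then show ?thesis using major_u not_grown_root by blast
next
  case False
  then obtain v where v: "grown u v w" using assms verts_S by (auto simp: major_def)
  then have "\<not> stops v w" "vdegree G w = 3"
    using vdegree_S(2)[OF v] assms by (auto simp: major_def split: if_splits)
  moreover have "w \<in> verts G" using grown_adj(1)[OF v] adj_verts by blast
  ultimately show ?thesis using v grown_parent_unique by (auto simp: major_def)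
qed

lemma run_S_imp: "run S v p \<Longrightarrow> run G v p"
proof (induction p arbitrary: v rule: induct_list012)
  case (2 y)
  then show ?case using S.adj_verts vdegree_S_2 adj_S_imp by auto
next
  case (3 y z p)
  then show ?case using S.adj_verts vdegree_S_2 adj_S_imp by auto
qed simp

text \<open>Degree 2 means the same in both trees, so a chain of the subtree is the chain of the
  ambient tree with the same first step.\<close>

lemma tochain_S:
  assumes "adj S v x" shows "S.tochain v x = tochain v x"
proof -
  obtain q where q: "S.ochain v x = x # q" by (simp add: S.ochain_def)
  have "run G v (x # q)" using S.run_ochain[OF assms] run_S_imp unfolding q by blast
  then have "ochain v x = x # q" by (rule ochain_eq)
  then show ?thesis unfolding tochain_def S.tochain_def q by simp
qed

lemma chains_to_S: "major S w \<Longrightarrow> chains_to S w = tochain w ` nbrs S w"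
  using S.chains_to_eq[of w] tochain_S S.mem_nbrs by (auto simp: major_def)

text \<open>Growth can stop only at a major vertex, hence never inside a chain.\<close>

lemma grown_far: "grown u v x \<Longrightarrow> grown u (entry v x) (far v x)"
proof (induction "clen v x" arbitrary: v x)
  case 0
  then show ?case using clen_0[OF grown_adj(1)[OF 0(2)]] by simp
next
  case (Suc k)
  obtain z where z: "vdegree G x = 2" "z \<noteq> v" "adj G x z" "far v x = far x z"
    "entry v x = entry x z" "clen x z = k"
    using clen_Suc[OF grown_adj(1)[OF Suc.prems]] Suc.hyps(2) by metis
  then have "\<not> stops v x" by (simp add: stops_def major_def)
  then have "grown u x z" using Suc.prems z grown.step by blast
  then show ?case using Suc.hyps(1)[of x z] z by simp
qed

text \<open>The first vertex of degree other than 2 on the way up is the root or has both a parent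
  and a child; in the latter case it is major and growth went past it. Hence open chains of the
  subtree lead away from the root.\<close>

lemma far_towards_root: "grown u y x \<Longrightarrow> major G (far x y) \<and> \<not> leaf S (far x y)"
proof (induction rule: grown.induct)
  case (root x)
  then have "far x u = u" using far_simps(1)[of x u] adj_sym major_vdegree[OF major_u] by blast
  then show ?case using major_u vdegree_S(1) by (simp add: leaf_def)
next
  case (step y x z)
  have zx: "adj G z x" "adj G x y" "adj G y x" using step.hyps(3) grown_adj[OF step.hyps(1)] adj_sym by blast+
  show ?case
  proof (cases "vdegree G x = 2")
    case True
    then show ?thesis using far_simps(2)[OF zx(1) True zx(2)] step by auto
  next
    case False
    have "\<not> leaf G x"
    proof
      assume "leaf G x"
      then obtain t where "nbrs G x = {t}" by (auto simp: leaf_def vdegree_nbrs card_1_singleton_iff)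
      then have "y = t" "z = t" using zx(2) step.hyps(3) mem_nbrs by blast+
      then show False using step.hyps(4) by simp
    qed
    then have "major G x" using leaf_or_major zx(2) False by blast
    then show ?thesis
      using far_simps(1)[OF zx(1) False] vdegree_S(2)[OF step.hyps(1)] step.hyps(2)
      by (simp add: leaf_def major_def)
  qed
qed

text \<open>The far end is a leaf of the subtree: either a leaf of the ambient tree or a vertex
  where growth stopped. In the second case \<open>reverse_ends\<close> turns the stopping condition
  into one on the chain seen from \<open>w\<close>.\<close>

lemma open_chain_S_cases:
  assumes w: "major S w" and x: "adj S w x" and o: "open_chain S k (tochain w x)"
  shows "grown u w x" and "leaf G (far w x) \<or> major G (far w x) \<and> (clen w x \<le> 1 \<or> ctype w x = 1)"
proof -
  have "leaf S (far w x)"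
    using o w by (auto simp: open_chain_def tochain_ends leaf_def major_def)
  then show g: "grown u w x" using x adj_S far_towards_root by blast
  have "stops (entry w x) (far w x) \<or> leaf G (far w x)"
  proof (cases "stops (entry w x) (far w x)")
    case False
    then have "vdegree G (far w x) = 1"
      using \<open>leaf S (far w x)\<close> vdegree_S(2)[OF grown_far[OF g]] by (simp add: leaf_def)
    then show ?thesis using \<open>leaf S (far w x)\<close> verts_S_subset by (auto simp: leaf_def)
  qed simp
  then show "leaf G (far w x) \<or> major G (far w x) \<and> (clen w x \<le> 1 \<or> ctype w x = 1)"
    using reverse_ends[OF grown_adj(1)[OF g]] major_S[OF w] major_vdegree by (auto simp: stops_def)
qed

text \<open>A leaf gives weight 1, and among the types (1,k) only (1,3) gives another weight, namely
  2.\<close>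

lemma open_chain_S_weight:
  assumes w: "major S w" and x: "adj S w x" and o: "open_chain S k (tochain w x)"
    and long: "\<not> (major G (far w x) \<and> clen w x \<le> 1)"
  shows "weight w x = 1 \<or> weight w x = 2 \<and> major G (far w x) \<and> clen w x = 3"
proof -
  have a: "adj G w x" and m: "major G w" using adj_S_imp x major_S[OF w] by auto
  from open_chain_S_cases[OF w x o] long
  consider "leaf G (far w x)" | "major G (far w x)" "\<not> leaf G (far w x)" "clen w x \<ge> 2" "ctype w x = 1"
    using not_leaf_major by force
  then show ?thesis
  proof cases
    case 1
    then show ?thesis using weight_rec[OF m a] by simp
  next
    case 2
    then have "weight w x = weight_of_type 1 (clen w x)" using weight_rec[OF m a] by simp
    then show ?thesis using 2 by (auto simp: weight_of_type_def)
  qed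
qed

lemma gen_major_handle_S:
  assumes bad: "bad_vertex G u" and w: "gen_major_handle S w"
  shows "(\<exists>p\<in>chains_to S w. \<exists>q\<in>chains_to S w. p \<noteq> q \<and> (\<exists>k. open_chain S k p) \<and>
           (\<exists>k. open_chain S k q) \<and> closed_chain G 3 p \<and> closed_chain G 3 q) \<or>
         (\<exists>p\<in>chains_to S w. closed_chain G 0 p \<or> closed_chain G 1 p)"
proof -
  have mS: "major S w" using w by (simp add: gen_major_handle_def)
  then have m: "major G w" using major_S by blast
  note ch = chains_to_S[OF mS]
  obtain x y k l where xy: "adj S w x" "adj S w y" "x \<noteq> y"
    and o: "open_chain S k (tochain w x)" "open_chain S l (tochain w y)"
    using w unfolding gen_major_handle_def ch by (auto simp: S.mem_nbrs inj_tochain)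
  have a: "adj G w x" "adj G w y" using xy adj_S_imp by blast+
  have g: "grown u w x" "grown u w y" using open_chain_S_cases(1)[OF mS] xy o by blast+
  have c: "tochain w x \<in> chains_to S w" "tochain w y \<in> chains_to S w"
    using xy unfolding ch by (auto simp: S.mem_nbrs)
  show ?thesis
  proof (cases "major G (far w x) \<and> clen w x \<le> 1 \<or> major G (far w y) \<and> clen w y \<le> 1")
    case True
    then have "(closed_chain G 0 (tochain w x) \<or> closed_chain G 1 (tochain w x)) \<or>
      closed_chain G 0 (tochain w y) \<or> closed_chain G 1 (tochain w y)"
      using closed_tochain_iff[OF m a(1)] closed_tochain_iff[OF m a(2)] by (auto simp: le_Suc_eq)
    then show ?thesis using c by blast
  next
    case False
    let ?closed3 = "\<lambda>x. major G (far w x) \<and> clen w x = 3"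
    have wx: "weight w x = 1 \<or> weight w x = 2 \<and> ?closed3 x"
      and wy: "weight w y = 1 \<or> weight w y = 2 \<and> ?closed3 y"
      using open_chain_S_weight[OF mS] xy o False by blast+
    have "?closed3 x \<and> ?closed3 y"
    \<comment> \<open>At the root badness decides. Under (B1) one chain is a closed 3-chain and the
      other two weights are even; under (B2) at most one weight is 1 or 2; under (B3) no weight is
      1.\<close>
    proof (cases "w = u")
      case True
      obtain p q r where pqr: "nbrs G u = {p, q, r}" "distinct [p, q, r]" "bad_at u p q r"
        using bad bad_vertex_iff by blast
      then have mem: "x \<in> {p, q, r}" "y \<in> {p, q, r}" using a True mem_nbrs by blast+
      have adj: "adj G u p" "adj G u q" "adj G u r" using pqr(1) by (auto simp flip: mem_nbrs)
      from pqr(3) consider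
        "?closed3 p" "type_of_weights (weight w q) (weight w r) = 2"
        | "weight w p = weight w q" "weight w p \<in> {6, 10, 15}"
        | "gcd (weight w p) (gcd (weight w q) (weight w r)) > 1"
        unfolding True by (auto simp: bad_at_def)
      then show ?thesis
      proof cases
        case 1
        then have "2 dvd weight w q \<and> 2 dvd weight w r"
          using type_of_weights_2[OF weight_mem[OF m] weight_mem[OF m]] adj True by blast
        then have "?closed3 z" if "z \<in> {p, q, r}" "weight w z = 1 \<or> weight w z = 2 \<and> ?closed3 z" for z
          using that 1(1) by auto
        then show ?thesis using mem wx wy by blast
      next
        case 2
        then show ?thesis using mem wx wy xy(3) by auto
      next
        case 3
        then have "weight w z \<noteq> 1" if "z \<in> {p, q, r}" for z using that by auto
        then show ?thesis using mem wx wy by blast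
      qed
    next
      case False
      then obtain v where v: "grown u v w" using g(1) by (auto elim: grown.cases)
      then have ns: "\<not> stops v w" using major_S[OF mS] by blast
      have "v \<noteq> x" "v \<noteq> y" using g grown_asym v by blast+
      then have d: "distinct [v, x, y]" using xy by simp
      have n: "nbrs G w = {v, x, y}"
        using major_nbrs_eq[OF m grown_adj(2)[OF v] a d] .
      note re = reverse_ends[OF grown_adj(2)[OF v]]
      \<comment> \<open>Weights from 1 and 2 that are not both 2 are coprime; they would give type
        1, and growth would have stopped at \<open>w\<close>.\<close>
      have "ctype (far w v) (entry w v) = type_of_weights (weight w x) (weight w y)"
        using ctype_eq[of "far w v" "entry w v" x y] re m major_vdegree n d by simp
      moreover have "ctype (far w v) (entry w v) \<noteq> 1"
        using ns m far_towards_root[OF v] by (simp add: stops_def)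
      ultimately show ?thesis using wx wy by (auto simp: type_of_weights_def)
    qed
    then have "closed_chain G 3 (tochain w x)" "closed_chain G 3 (tochain w y)"
      using closed_tochain_iff[OF m] a by simp_all
    moreover have "tochain w x \<noteq> tochain w y" using xy inj_tochain by simp
    ultimately show ?thesis using c o by blast
  qed
qed

section \<open>Condition (3) and the bad strong subtree\<close>

lemma stops_adjacent: "grown u a b \<Longrightarrow> major G a \<Longrightarrow> major G b \<Longrightarrow> stops a b"
  using far_simps(1)[of b a] grown_adj major_vdegree by (simp add: stops_def)

lemma majors_S_not_adjacent:
  assumes "major S a" "major S b" shows "\<not> adj S a b"
  using assms major_S stops_adjacent adj_S by metis

text \<open>One of the two would be the parent of \<open>x\<close> and the other its child; the
  1-chain between them makes growth stop at the child, which is then a leaf of the subtree.\<close>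

lemma majors_S_no_common_nbr:
  assumes x: "vdegree S x = 2" "adj S x a" "adj S x b" and ab: "major S a" "major S b"
  shows "a = b"
proof (rule ccontr)
  assume "a \<noteq> b"
  have "x \<in> verts S" "x \<noteq> u" using x S.adj_verts vdegree_S(1) by auto
  then obtain y where y: "grown u y x" using verts_S by blast
  then have ns: "vdegree G x = 2" "\<not> stops y x"
    using x(1) vdegree_S_2[OF \<open>x \<in> verts S\<close>] by (auto simp: stops_def major_def)
  have no: False if "y = c" "c \<noteq> d" "major S c" "major S d" "adj S x d" for c d
  proof -
    have g: "grown u x d" using that adj_S grown_parent_unique[OF y] by blast
    have "far d x = far x c \<and> clen d x = Suc (clen x c)"
      using far_simps(2)[of d x c] grown_adj[OF g] grown_adj[OF y] ns(1) that by blast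
    moreover have "far x c = c \<and> clen x c = 0"
      using far_simps(1)[of x c] grown_adj[OF y] that major_S major_vdegree by blast
    ultimately have "stops x d" using that major_S by (simp add: stops_def)
    then show False using g major_S that by blast
  qed
  have "{a, b} = nbrs S x"
    using x \<open>a \<noteq> b\<close> S.finite_nbrs by (intro card_subset_eq) (auto simp: S.mem_nbrs S.vdegree_nbrs)
  moreover have "y \<in> nbrs S x" using y adj_S S.mem_nbrs by blast
  ultimately have "y = a \<or> y = b" by blast
  then show False using no[of a b] no[of b a] \<open>a \<noteq> b\<close> ab x by blast
qed

lemma bad_strong_subtree_S:
  assumes "bad_vertex G u" shows "bad_strong_subtree S G"
proof -
  have "edges S \<subseteq> edges G" using grown_adj by (auto simp: grown_tree_def adj_def)
  then have "subtree S G" using tree_S verts_S_subset by (simp add: subtree_def)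
  then have "strong_subtree S G" using vdegree_S_2 by (auto simp: strong_subtree_def)
  moreover have "\<exists>v. major S v \<and> bad_vertex G v" using major_S_root assms by blast
  ultimately show ?thesis
    unfolding bad_strong_subtree_def
    using gen_major_handle_S[OF assms] majors_S_not_adjacent majors_S_no_common_nbr by blast
qed

end

theorem theorem2:
  fixes T :: "'a ugraph"
  assumes "tree T"
    and "max_degree T = 3"
    and "card {v. major T v} \<ge> 2"
  shows "lambda_number T = 4 \<longleftrightarrow> good_tree T"
proof -
  interpret subcubic_tree T using assms by unfold_locales
  \<comment> \<open>A tree is bad exactly if it has a bad vertex: the growing construction gives one
    direction, condition (4) the other.\<close>
  have "bad_tree T" if "bad_vertex T u" for u
  proof -
    interpret rooted_subcubic_tree T u
      using that by unfold_locales (simp add: bad_vertex_def)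
    show ?thesis using bad_strong_subtree_S[OF that] by (auto simp: bad_tree_def)
  qed
  moreover have "\<exists>u. bad_vertex T u" if "bad_tree T"
    using that by (auto simp: bad_tree_def bad_strong_subtree_def)
  ultimately show ?thesis
    unfolding lambda_number_4 good_tree_def
    using good_labelable bad_vertex_not_labelable by blast
qed

end
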